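(* Let $X$ be a complex Banach space, let $\eta:[0,\infty[\to]0,\infty[$ be a decreasing continuous function such that $\lim_{t\to\infty}t^k\eta(t)=0$ for every $k\in\mathbb N$, and let $W=\{w_n\}_{n\ge1}$ be the family of weights on $X$ given by $w_n(x)=\eta(\|x\|/n)$. Then $\big(\mathcal P W(^nX)\big)_n$ is an $\infty$-Schauder decomposition of $HW(X)$.
   Context: $HW(X)$ is the space of holomorphic $f:X\to\mathbb C$ with $\|f\|_{w_n}:=\sup_{x\in X}w_n(x)|f(x)|<\infty$ for all $n$, endowed with the Fréchet topology defined by these seminorms. $\mathcal P(^nX)$ ($n=0,1,2,\dots$) is the space of continuous $n$-homogeneous polynomials on $X$, and $\mathcal PW(^nX)=\mathcal P(^nX)\cap HW(X)$, considered as a Banach space with the norm $\|P\|_w=\sup_{x\in X}|P(x)|\,\eta(\|x\|)$, where $w=w_1$ (this norm induces on $\mathcal PW(^nX)$ the topology of $HW(X)$). A sequence $(F_n)_n$ of subspaces of a Fréchet space $F$ is a Schauder decomposition of $F$ if each $x\in F$ can be written in a unique way as a convergent series $x=\sum_n x_n$ with $x_n\in F_n$, and the projections $x\mapsto\sum_{n\le m}x_n$ are continuous. A Schauder decomposition by Banach spaces $(F_n,\|\cdot\|)$ is an $R$-Schauder decomposition ($0<R\le\infty$) if, for every sequence $(x_n)_n$ with $x_n\in F_n$, the series $\sum_n x_n$ converges in $F$ if and only if $\limsup_n\|x_n\|^{1/n}\le 1/R$ (with $1/\infty=0$). *)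

theory Defs
  imports "HOL-Analysis.Analysis" "HOL-Library.Function_Algebras"
begin

section \<open>Complex Banach spaces\<close>

class complex_banach = banach +
  fixes scaleC :: "complex \<Rightarrow> 'a \<Rightarrow> 'a" (infixr "*\<^sub>C" 75)
  assumes scaleC_add_right: "a *\<^sub>C (x + y) = a *\<^sub>C x + a *\<^sub>C y"
    and scaleC_add_left: "(a + b) *\<^sub>C x = a *\<^sub>C x + b *\<^sub>C x"
    and scaleC_scaleC: "a *\<^sub>C b *\<^sub>C x = (a * b) *\<^sub>C x"
    and scaleC_of_real: "of_real r *\<^sub>C x = r *\<^sub>R x"
    and norm_scaleC: "norm (a *\<^sub>C x) = cmod a * norm x"

instantiation complex :: complex_banach
begin

definition scaleC_complex :: "complex \<Rightarrow> complex \<Rightarrow> complex"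
  where "scaleC_complex a x = a * x"

instance
  by standard (auto simp: scaleC_complex_def algebra_simps norm_mult scaleR_conv_of_real)

end

definition clinear_functional :: "('a::complex_banach \<Rightarrow> complex) \<Rightarrow> bool"
  where "clinear_functional \<phi> \<longleftrightarrow> Vector_Spaces.linear scaleC (*) \<phi>"


section \<open>Locally convex topologies, Banach and Frechet spaces\<close>

text \<open>
  The spaces below are subspaces \<open>V\<close> of a type \<open>'f\<close> that is an ambient complex vector
  space with scalar multiplication \<open>s\<close>; seminorms only matter on \<open>V\<close>.
\<close>

definition seminorm_on :: "(complex \<Rightarrow> 'f::ab_group_add \<Rightarrow> 'f) \<Rightarrow> 'f set \<Rightarrow> ('f \<Rightarrow> real) \<Rightarrow> bool"
  where "seminorm_on s V q \<longleftrightarrow>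
    (\<forall>x\<in>V. 0 \<le> q x) \<and>
    (\<forall>x\<in>V. \<forall>y\<in>V. q (x + y) \<le> q x + q y) \<and>
    (\<forall>c. \<forall>x\<in>V. q (s c x) = cmod c * q x)"

definition seminorm_topology :: "'f::ab_group_add set \<Rightarrow> ('f \<Rightarrow> real) set \<Rightarrow> 'f topology"
  where "seminorm_topology V Q =
    topology_generated_by {{y \<in> V. q (y - x) < e} | q x e. q \<in> Q \<and> x \<in> V \<and> 0 < e}"

definition cauchy_for :: "('f::ab_group_add \<Rightarrow> real) set \<Rightarrow> (nat \<Rightarrow> 'f) \<Rightarrow> bool"
  where "cauchy_for Q u \<longleftrightarrow>
    (\<forall>q\<in>Q. \<forall>e>0. \<exists>N. \<forall>m\<ge>N. \<forall>n\<ge>N. q (u m - u n) < e)"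

text \<open>
  Separated and sequentially complete, hence metrizable and complete when \<open>Q\<close> is countable.
\<close>

definition complete_separating ::
    "(complex \<Rightarrow> 'f::ab_group_add \<Rightarrow> 'f) \<Rightarrow> 'f set \<Rightarrow> ('f \<Rightarrow> real) set \<Rightarrow> bool"
  where "complete_separating s V Q \<longleftrightarrow>
    vector_space s \<and> module.subspace s V \<and>
    (\<forall>q\<in>Q. seminorm_on s V q) \<and>
    (\<forall>x\<in>V. (\<forall>q\<in>Q. q x = 0) \<longrightarrow> x = 0) \<and>
    (\<forall>u. (\<forall>n. u n \<in> V) \<and> cauchy_for Q u \<longrightarrow>
      (\<exists>x. limitin (seminorm_topology V Q) u x sequentially))"

definition frechet_space ::
    "(complex \<Rightarrow> 'f::ab_group_add \<Rightarrow> 'f) \<Rightarrow> 'f set \<Rightarrow> 'f topology \<Rightarrow> bool"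
  where "frechet_space s V T \<longleftrightarrow>
    (\<exists>p :: nat \<Rightarrow> 'f \<Rightarrow> real.
      complete_separating s V (range p) \<and> T = seminorm_topology V (range p))"

definition banach_space ::
    "(complex \<Rightarrow> 'f::ab_group_add \<Rightarrow> 'f) \<Rightarrow> 'f set \<Rightarrow> ('f \<Rightarrow> real) \<Rightarrow> bool"
  where "banach_space s V N \<longleftrightarrow> complete_separating s V {N}"


section \<open>Schauder decompositions\<close>

definition expansion ::
    "'f::ab_group_add topology \<Rightarrow> (nat \<Rightarrow> 'f set) \<Rightarrow> 'f \<Rightarrow> (nat \<Rightarrow> 'f) \<Rightarrow> bool"
  where "expansion T F x y \<longleftrightarrow>
    (\<forall>n. y n \<in> F n) \<and> limitin T (\<lambda>m. \<Sum>n<m. y n) x sequentially"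

definition schauder_projection ::
    "'f::ab_group_add topology \<Rightarrow> (nat \<Rightarrow> 'f set) \<Rightarrow> nat \<Rightarrow> 'f \<Rightarrow> 'f"
  where "schauder_projection T F m x = (\<Sum>n\<le>m. (THE y. expansion T F x y) n)"

definition schauder_decomposition ::
    "(complex \<Rightarrow> 'f::ab_group_add \<Rightarrow> 'f) \<Rightarrow> 'f set \<Rightarrow> 'f topology \<Rightarrow> (nat \<Rightarrow> 'f set) \<Rightarrow> bool"
  where "schauder_decomposition s V T F \<longleftrightarrow>
    frechet_space s V T \<and>
    (\<forall>n. module.subspace s (F n) \<and> F n \<subseteq> V) \<and>
    (\<forall>x\<in>V. \<exists>!y. expansion T F x y) \<and>
    (\<forall>m. continuous_map T T (schauder_projection T F m))"

text \<open>
  The norm of each \<open>F n\<close> has to induce the topology inherited from the Frechet space.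
  In \<^typ>\<open>ereal\<close>, \<open>1 / \<infinity> = 0\<close>; the value \<open>root 0 _ = 0\<close> does not affect the limsup.
\<close>

definition R_schauder_decomposition ::
    "(complex \<Rightarrow> 'f::ab_group_add \<Rightarrow> 'f) \<Rightarrow> 'f set \<Rightarrow> 'f topology \<Rightarrow> (nat \<Rightarrow> 'f set) \<Rightarrow>
      (nat \<Rightarrow> 'f \<Rightarrow> real) \<Rightarrow> ereal \<Rightarrow> bool"
  where "R_schauder_decomposition s V T F N R \<longleftrightarrow>
    0 < R \<and>
    schauder_decomposition s V T F \<and>
    (\<forall>n. banach_space s (F n) (N n) \<and> seminorm_topology (F n) {N n} = subtopology T (F n)) \<and>
    (\<forall>y. (\<forall>n. y n \<in> F n) \<longrightarrow>
      ((\<exists>x. limitin T (\<lambda>m. \<Sum>n<m. y n) x sequentially) \<longleftrightarrow>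
       limsup (\<lambda>n. ereal (root n (N n (y n)))) \<le> 1 / R))"


section \<open>Holomorphic functions and homogeneous polynomials\<close>

definition cscale :: "complex \<Rightarrow> ('a \<Rightarrow> complex) \<Rightarrow> 'a \<Rightarrow> complex"
  where "cscale c f = (\<lambda>x. c * f x)"

definition holomorphic_fun :: "('a::complex_banach \<Rightarrow> complex) \<Rightarrow> bool"
  where "holomorphic_fun f \<longleftrightarrow>
    (\<forall>x. \<exists>D. clinear_functional D \<and> (f has_derivative D) (at x))"

text \<open>An \<open>n\<close>-linear form is a function on lists, of which only the lists of length \<open>n\<close> matter.\<close>

definition multilinear_form :: "nat \<Rightarrow> ('a::complex_banach list \<Rightarrow> complex) \<Rightarrow> bool"
  where "multilinear_form n A \<longleftrightarrow>
    (\<forall>xs i. length xs = n \<and> i < n \<longrightarrow> clinear_functional (\<lambda>u. A (xs[i := u])))"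

definition homogeneous_polynomial :: "nat \<Rightarrow> ('a::complex_banach \<Rightarrow> complex) \<Rightarrow> bool"
  where "homogeneous_polynomial n P \<longleftrightarrow>
    (\<exists>A. multilinear_form n A \<and> (\<forall>x. P x = A (replicate n x)))"

definition continuous_polynomials :: "nat \<Rightarrow> ('a::complex_banach \<Rightarrow> complex) set"
  where "continuous_polynomials n = {P. homogeneous_polynomial n P \<and> continuous_on UNIV P}"


section \<open>Weighted spaces\<close>

definition weight :: "(real \<Rightarrow> real) \<Rightarrow> nat \<Rightarrow> 'a::complex_banach \<Rightarrow> real"
  where "weight \<eta> n x = \<eta> (norm x / real n)"

definition weighted_norm :: "('a \<Rightarrow> real) \<Rightarrow> ('a \<Rightarrow> complex) \<Rightarrow> real"
  where "weighted_norm w f = (SUP x. w x * cmod (f x))"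

definition HW :: "(real \<Rightarrow> real) \<Rightarrow> ('a::complex_banach \<Rightarrow> complex) set"
  where "HW \<eta> = {f. holomorphic_fun f \<and>
    (\<forall>n\<ge>1. bdd_above (range (\<lambda>x. weight \<eta> n x * cmod (f x))))}"

definition HW_topology :: "(real \<Rightarrow> real) \<Rightarrow> ('a::complex_banach \<Rightarrow> complex) topology"
  where "HW_topology \<eta> = seminorm_topology (HW \<eta>) {weighted_norm (weight \<eta> n) | n. n \<ge> 1}"

definition PW :: "(real \<Rightarrow> real) \<Rightarrow> nat \<Rightarrow> ('a::complex_banach \<Rightarrow> complex) set"
  where "PW \<eta> n = continuous_polynomials n \<inter> HW \<eta>"

definition PW_norm :: "(real \<Rightarrow> real) \<Rightarrow> ('a::complex_banach \<Rightarrow> complex) \<Rightarrow> real"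
  where "PW_norm \<eta> = weighted_norm (weight \<eta> 1)"

end

theory Submission
  imports Defs "HOL-Complex_Analysis.Cauchy_Integral_Formula"
begin

text \<open>
  The \<open>n\<close>-th component of \<open>f\<close> is its Taylor component \<open>f\<^sub>n x\<close>, the \<open>n\<close>-th coefficient of
  \<open>c \<mapsto> f (c x)\<close>. Iterated directional derivatives at \<open>0\<close> exhibit \<open>f\<^sub>n\<close> as a homogeneous
  polynomial. As \<open>w\<^bsub>2k\<^esub>(c x) = w\<^sub>k(x)\<close> for \<open>\<bar>c\<bar> = 2\<close>, Cauchy's estimate on slices gives
  \<open>w\<^sub>k(x) \<bar>f\<^sub>n x\<bar> \<le> 2\<^sup>-\<^sup>n \<parallel>f\<parallel>\<close> for the seminorm with index \<open>2k\<close>, hence convergence of the Taylor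
  series in \<open>HW\<close> and continuity of the projections. For an \<open>n\<close>-homogeneous \<open>P\<close> the \<open>k\<close>-th seminorm
  is \<open>k\<^sup>n\<close> times the first one, so convergence of \<open>\<Sum> P\<^sub>n\<close> in all seminorms amounts to
  \<open>\<parallel>P\<^sub>n\<parallel>\<^sup>1\<^sup>/\<^sup>n \<rightarrow> 0\<close>.
\<close>

section \<open>Entire functions of one variable\<close>

text \<open>Holomorphy means complex Frechet differentiability on a possibly infinite-dimensional
  space, whereas Cauchy's estimates live on complex lines. The bridge is always the same: a function
  is exhibited as a locally uniform limit of holomorphic ones, the uniformity coming from estimates
  on slices. Iterated directional derivatives need it, since \<open>dirderiv f h\<close> has to be
  differentiable again. So does holomorphy of \<open>taylor_component n f\<close>: the multilinear
  form that makes a component a polynomial carries no continuity, so differentiability needs an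
  argument of its own. That argument asks for bounds on whole balls, which entire functions on
  infinite-dimensional spaces may fail to have and which membership in \<open>HW\<close> provides.
  The radius 2 meets two demands: exceeding 1 yields a geometric factor, and being an integer keeps
  \<open>2 * k\<close> among the indices of the weights. Inside \<open>HW\<close> the space
  \<open>PW \<eta> n\<close> is cut out by the pointwise identity
  \<open>f (c *\<^sub>C x) = c ^ n * f x\<close>, which survives limits; its completeness thus
  reduces to that of \<open>HW\<close>.\<close>

lemma power_series_coefficient:
  fixes \<phi> :: "complex \<Rightarrow> complex"
  assumes "\<And>c. (\<lambda>n. a n * c ^ n) sums \<phi> c"
  shows "(deriv ^^ n) \<phi> 0 / fact n = a n"
proof -
  have "\<phi> has_fps_expansion Abs_fps a"
    using assms by (intro has_fps_expansionI) simp
  from fps_nth_fps_expansion[OF this, of n] show ?thesis by simp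
qed

lemma Cauchy_estimate_entire:
  assumes "\<phi> holomorphic_on UNIV" "0 < \<rho>" "\<And>c. cmod c = \<rho> \<Longrightarrow> cmod (\<phi> c) \<le> M"
  shows "cmod ((deriv ^^ n) \<phi> 0) \<le> fact n * M / \<rho> ^ n"
  using assms
  by (intro Cauchy_inequality)
     (auto intro: holomorphic_on_subset holomorphic_on_imp_continuous_on)

text \<open>Cauchy's estimate bounds the \<open>m\<close>-th term by
  \<open>M * (cmod t / \<rho>) ^ m\<close>; staying within half the radius keeps the ratio at most
  1/2, so summing the geometric tail costs at most the factor 2. The order \<open>n\<close> is 2 for
  difference quotients, \<open>Suc n\<close> for isolating one Taylor component, and arbitrary for
  convergence in \<open>HW\<close>.\<close>

lemma taylor_remainder_bound:
  assumes hol: "\<phi> holomorphic_on UNIV" and \<rho>: "0 < \<rho>"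
    and M: "\<And>c. cmod c = \<rho> \<Longrightarrow> cmod (\<phi> c) \<le> M"
    and t: "cmod t \<le> \<rho> / 2"
  shows "cmod (\<phi> t - (\<Sum>m<n. (deriv ^^ m) \<phi> 0 / fact m * t ^ m)) \<le> 2 * M * (cmod t / \<rho>) ^ n"
proof -
  let ?a = "\<lambda>m. (deriv ^^ m) \<phi> 0 / fact m * t ^ m"
  let ?r = "cmod t / \<rho>"
  have r: "0 \<le> ?r" "?r \<le> 1/2"
    using \<rho> t by (auto simp: field_simps)
  have "cmod (\<phi> (of_real \<rho>)) \<le> M"
    using \<rho> by (intro M) auto
  then have M0: "0 \<le> M"
    using norm_ge_zero order_trans by blast
  have a: "cmod (?a m) \<le> M * ?r ^ m" for m
  proof -
    have "cmod (?a m) = cmod ((deriv ^^ m) \<phi> 0) / fact m * cmod t ^ m"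
      by (simp add: norm_mult norm_divide norm_power)
    also have "\<dots> \<le> (fact m * M / \<rho> ^ m) / fact m * cmod t ^ m"
      by (intro mult_right_mono divide_right_mono Cauchy_estimate_entire[OF hol \<rho> M]) auto
    also have "\<dots> = M * ?r ^ m"
      by (simp add: power_divide)
    finally show ?thesis .
  qed
  have "?a sums \<phi> t"
    using holomorphic_power_series[of \<phi> 0 "cmod t + 1" t] hol
    by (auto intro: holomorphic_on_subset)
  then have tail: "(\<lambda>m. ?a (m + n)) sums (\<phi> t - (\<Sum>m<n. ?a m))"
    by (rule sums_split_initial_segment)
  have r1: "norm ?r < 1"
    using r abs_of_nonneg[OF r(1)] unfolding real_norm_def by linarith
  have geo: "(\<lambda>m. M * ?r ^ n * ?r ^ m) sums (M * ?r ^ n * (1 / (1 - ?r)))"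
    by (rule sums_mult[OF geometric_sums[OF r1]])
  have "cmod (\<Sum>m. ?a (m + n)) \<le> (\<Sum>m. M * ?r ^ n * ?r ^ m)"
    using a[of "_ + n"] geo
    by (intro norm_suminf_le) (auto simp: power_add mult_ac sums_iff)
  also have "\<dots> = M * ?r ^ n * (1 / (1 - ?r))"
    using geo by (simp add: sums_iff)
  also have "\<dots> \<le> M * ?r ^ n * 2"
    using r M0 \<rho> by (intro mult_left_mono) (auto simp: field_simps)
  finally show ?thesis
    using tail by (simp add: sums_iff mult_ac)
qed

lemma small_multiple:
  fixes a r :: real
  assumes "0 < r" "0 \<le> a"
  obtains d where "0 < d" "d * a < r"
proof
  show "0 < r / (a + 1)" "r / (a + 1) * a < r"
    using assms by (auto simp: divide_simps)
qed

lemma uniform_limit_dominated: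
  fixes b :: "nat \<Rightarrow> real"
  assumes "\<forall>\<^sub>F n in sequentially. \<forall>x\<in>S. dist (f n x) (g x) \<le> b n" and b: "b \<longlonglongrightarrow> 0"
  shows "uniform_limit S f g sequentially"
proof (rule uniform_limitI)
  fix e :: real assume "0 < e"
  then have "\<forall>\<^sub>F n in sequentially. b n < e"
    using b by (rule order_tendstoD(2)[rotated])
  with assms(1) show "\<forall>\<^sub>F n in sequentially. \<forall>x\<in>S. dist (f n x) (g x) < e"
    by eventually_elim force
qed

section \<open>Complex scalars\<close>

context
  fixes x :: "'a::complex_banach"
begin

lemma scaleC_zero_left [simp]: "0 *\<^sub>C x = 0"
  using scaleC_add_left[of 0 0 x] by simp

lemma scaleC_one [simp]: "1 *\<^sub>C x = x"
  using scaleC_of_real[of 1 x] by simp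

lemma scaleC_zero_right [simp]: "c *\<^sub>C (0::'a) = 0"
  using scaleC_add_right[of c 0 "0::'a"] by simp

lemma scaleC_scaleR: "(r *\<^sub>R c) *\<^sub>C x = r *\<^sub>R (c *\<^sub>C x)"
  by (metis scaleC_of_real scaleC_scaleC scaleR_conv_of_real)

lemma scaleC_diff_left: "(a - b) *\<^sub>C x = a *\<^sub>C x - b *\<^sub>C x"
  using scaleC_add_left[of "a - b" b x] by (simp add: algebra_simps)

lemma bounded_linear_scaleC_left: "bounded_linear (\<lambda>c. c *\<^sub>C x)"
  by (rule bounded_linear_intro[where K = "norm x"])
     (auto simp: scaleC_add_left scaleC_scaleR norm_scaleC mult.commute)

lemma scaleC_scaleR_right: "c *\<^sub>C (r *\<^sub>R x) = r *\<^sub>R (c *\<^sub>C x)"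
  by (metis scaleC_of_real scaleC_scaleC mult.commute)

end

lemma bounded_linear_scaleC_right: "bounded_linear (\<lambda>x::'a::complex_banach. c *\<^sub>C x)"
  by (rule bounded_linear_intro[where K = "cmod c"])
     (auto simp: scaleC_add_right norm_scaleC mult.commute scaleC_scaleR_right)

lemma vector_space_scaleC: "vector_space (scaleC :: complex \<Rightarrow> 'a::complex_banach \<Rightarrow> 'a)"
  by unfold_locales (auto simp: scaleC_add_right scaleC_add_left scaleC_scaleC)

lemma vector_space_times: "vector_space ((*) :: complex \<Rightarrow> complex \<Rightarrow> complex)"
  by unfold_locales (auto simp: algebra_simps)

lemma clinear_functional_iff:
  "clinear_functional \<phi> \<longleftrightarrow>
    (\<forall>x y. \<phi> (x + y) = \<phi> x + \<phi> y) \<and> (\<forall>c x. \<phi> (c *\<^sub>C x) = c * \<phi> x)"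
  unfolding clinear_functional_def Vector_Spaces.linear_iff
  using vector_space_scaleC vector_space_times by auto

section \<open>Directional derivatives\<close>

text \<open>The direction precedes the point, so that \<open>dirderiv f h\<close> is again a
  function on the space and \<open>foldl dirderiv f hs\<close> iterates over a list of directions.
  Being a one-variable derivative, it can be handled for functions known to be holomorphic only
  along lines.\<close>

definition dirderiv :: "('a::complex_banach \<Rightarrow> complex) \<Rightarrow> 'a \<Rightarrow> 'a \<Rightarrow> complex"
  where "dirderiv f h x = deriv (\<lambda>c. f (x + c *\<^sub>C h)) 0"

lemma slice_has_field_derivative:
  assumes "(f has_derivative D) (at (x + c *\<^sub>C h))" "clinear_functional D"
  shows "((\<lambda>c. f (x + c *\<^sub>C h)) has_field_derivative D h) (at c)"
proof -
  have "((\<lambda>c. x + c *\<^sub>C h) has_derivative (\<lambda>d. d *\<^sub>C h)) (at c)"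
    by (intro has_derivative_add[where f' = "\<lambda>_. 0", simplified]
        bounded_linear_imp_has_derivative bounded_linear_scaleC_left) auto
  from diff_chain_at[OF this assms(1)]
  show ?thesis
    using assms(2) by (simp add: has_field_derivative_def o_def clinear_functional_iff mult.commute[of _ "D h"])
qed

context
  fixes f :: "'a::complex_banach \<Rightarrow> complex"
  assumes f: "holomorphic_fun f"
begin

text \<open>Restriction to lines recovers every value \<open>D h\<close> as a slice derivative, so
  the derivative that is merely assumed to exist is the explicit \<open>dirderiv\<close>.\<close>

lemma has_derivative_dirderiv:
  "clinear_functional (\<lambda>h. dirderiv f h x)" "(f has_derivative (\<lambda>h. dirderiv f h x)) (at x)"
proof -
  obtain D where D: "clinear_functional D" "(f has_derivative D) (at x)"
    using f unfolding holomorphic_fun_def by blast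
  then have "(\<lambda>h. dirderiv f h x) = D"
    using slice_has_field_derivative[of f D x 0]
    by (auto simp: dirderiv_def intro!: DERIV_imp_deriv)
  with D show "clinear_functional (\<lambda>h. dirderiv f h x)" "(f has_derivative (\<lambda>h. dirderiv f h x)) (at x)"
    by auto
qed

lemma slice_DERIV:
  "((\<lambda>c. f (x + c *\<^sub>C h)) has_field_derivative dirderiv f h (x + c *\<^sub>C h)) (at c)"
  by (intro slice_has_field_derivative has_derivative_dirderiv)

lemma slice_holomorphic: "(\<lambda>c. f (x + c *\<^sub>C h)) holomorphic_on UNIV"
  using slice_DERIV by (auto simp: holomorphic_on_def field_differentiable_def)

lemma slice0_holomorphic: "(\<lambda>c. f (c *\<^sub>C h)) holomorphic_on UNIV"
  using slice_holomorphic[of 0 h] by simp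

lemma deriv_slice: "deriv (\<lambda>c. f (x + c *\<^sub>C h)) = (\<lambda>c. dirderiv f h (x + c *\<^sub>C h))"
  by (intro ext DERIV_imp_deriv slice_DERIV)

lemma holomorphic_fun_isCont: "isCont f x"
  using has_derivative_continuous has_derivative_dirderiv(2) by blast

end

section \<open>Closure properties of holomorphic functions on a Banach space\<close>

lemma holomorphic_funI:
  assumes "\<And>x. clinear_functional (D x)" "\<And>x. (f has_derivative D x) (at x)"
  shows "holomorphic_fun f"
  using assms unfolding holomorphic_fun_def by blast

lemma holomorphic_fun_const: "holomorphic_fun (\<lambda>_. c)"
  by (rule holomorphic_funI[where D = "\<lambda>_ _. 0"]) (auto simp: clinear_functional_iff)

lemma holomorphic_fun_add:
  assumes "holomorphic_fun f" "holomorphic_fun g"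
  shows "holomorphic_fun (\<lambda>x. f x + g x)"
  using has_derivative_dirderiv[OF assms(1)] has_derivative_dirderiv[OF assms(2)]
  by (intro holomorphic_funI[where D = "\<lambda>x h. dirderiv f h x + dirderiv g h x"])
     (auto simp: clinear_functional_iff algebra_simps intro!: has_derivative_add)

lemma holomorphic_fun_cmult:
  assumes "holomorphic_fun f"
  shows "holomorphic_fun (\<lambda>x. c * f x)"
  using has_derivative_dirderiv[OF assms(1)]
  by (intro holomorphic_funI[where D = "\<lambda>x h. c * dirderiv f h x"])
     (auto simp: clinear_functional_iff algebra_simps intro!: has_derivative_mult_right)

lemma holomorphic_fun_diff:
  assumes "holomorphic_fun f" "holomorphic_fun g"
  shows "holomorphic_fun (\<lambda>x. f x - g x)"
  using holomorphic_fun_add[OF assms(1) holomorphic_fun_cmult[OF assms(2), of "-1"]] by simp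

lemma holomorphic_fun_sum:
  assumes "\<And>i. i \<in> I \<Longrightarrow> holomorphic_fun (f i)"
  shows "holomorphic_fun (\<lambda>x. \<Sum>i\<in>I. f i x)"
  using assms
  by (induction I rule: infinite_finite_induct)
     (auto intro: holomorphic_fun_const holomorphic_fun_add)

lemma holomorphic_fun_affine:
  assumes "holomorphic_fun f"
  shows "holomorphic_fun (\<lambda>x. f (c *\<^sub>C x + a))"
proof (rule holomorphic_funI)
  fix x
  let ?D = "\<lambda>h. dirderiv f h (c *\<^sub>C x + a)"
  show "clinear_functional (\<lambda>h. ?D (c *\<^sub>C h))"
    using has_derivative_dirderiv(1)[OF assms]
    by (simp add: clinear_functional_iff scaleC_add_right distrib_left)
  have "((\<lambda>x. c *\<^sub>C x + a) has_derivative (\<lambda>h. c *\<^sub>C h)) (at x)"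
    by (intro has_derivative_add[where g' = "\<lambda>_. 0", simplified]
        bounded_linear_imp_has_derivative bounded_linear_scaleC_right) auto
  from diff_chain_at[OF this has_derivative_dirderiv(2)[OF assms]]
  show "((\<lambda>x. f (c *\<^sub>C x + a)) has_derivative (\<lambda>h. ?D (c *\<^sub>C h))) (at x)"
    by (simp add: o_def)
qed

text \<open>From a point of the half ball, the disc of radius \<open>r / (2 * norm h)\<close> in
  direction \<open>h\<close> stays inside the full ball, so Cauchy's estimate gives a bound linear
  in \<open>norm h\<close>, that is, a bound in operator norm. Holomorphy is asked only of the
  slices because it is applied to a limit function not yet known to be Frechet
  differentiable.\<close>

lemma dirderiv_diff_bound:
  fixes x0 x h :: "'a::complex_banach"
  assumes hol: "(\<lambda>c. f (x + c *\<^sub>C h)) holomorphic_on UNIV" "(\<lambda>c. g (x + c *\<^sub>C h)) holomorphic_on UNIV"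
    and r: "0 < r" and x: "x \<in> ball x0 (r/2)"
    and B: "\<And>y. y \<in> ball x0 r \<Longrightarrow> cmod (f y - g y) \<le> B"
  shows "cmod (dirderiv f h x - dirderiv g h x) \<le> 2 * B / r * norm h"
proof (cases "h = 0")
  case True
  then show ?thesis by (simp add: dirderiv_def)
next
  case False
  define \<rho> where "\<rho> = r / (2 * norm h)"
  have \<rho>: "0 < \<rho>" "\<rho> * norm h = r / 2"
    using r False by (auto simp: \<rho>_def)
  let ?\<phi> = "\<lambda>c. f (x + c *\<^sub>C h) - g (x + c *\<^sub>C h)"
  have "deriv ?\<phi> 0 = dirderiv f h x - dirderiv g h x"
    using hol unfolding dirderiv_def
    by (intro deriv_diff holomorphic_on_imp_differentiable_at[OF _ open_UNIV]) auto
  moreover have "cmod ((deriv ^^ 1) ?\<phi> 0) \<le> fact 1 * B / \<rho> ^ 1"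
  proof (rule Cauchy_estimate_entire)
    show "cmod (?\<phi> c) \<le> B" if "cmod c = \<rho>" for c
    proof (rule B)
      have "dist x0 (x + c *\<^sub>C h) \<le> dist x0 x + norm (c *\<^sub>C h)"
        by (metis add_diff_cancel_left' dist_commute dist_norm dist_triangle)
      also have "\<dots> < r"
        using x \<rho>(2) that by (simp add: norm_scaleC)
      finally show "x + c *\<^sub>C h \<in> ball x0 r" by simp
    qed
  qed (use \<rho> hol in \<open>auto intro: holomorphic_on_diff\<close>)
  moreover have "B / \<rho> = 2 * B / r * norm h"
    using r False by (simp add: \<rho>_def)
  ultimately show ?thesis by simp
qed

text \<open>
  Cauchy's estimate on slices turns local uniform convergence of the functions into local uniform
  convergence of their derivatives in operator norm.
\<close>

lemma holomorphic_fun_uniform_limit: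
  fixes f :: "nat \<Rightarrow> 'a::complex_banach \<Rightarrow> complex"
  assumes f: "\<And>n. holomorphic_fun (f n)"
    and lim: "\<And>x. \<exists>r>0. uniform_limit (ball x r) f g sequentially"
  shows "holomorphic_fun g"
proof (rule holomorphic_funI)
  \<comment> \<open>Weierstrass' theorem on each complex line; it makes Cauchy's estimate available
    for \<open>g\<close> before its differentiability is known.\<close>
  have slice: "(\<lambda>c. g (x + c *\<^sub>C h)) holomorphic_on UNIV" for x h
  proof (rule holomorphic_uniform_sequence[where f = "\<lambda>n c. f n (x + c *\<^sub>C h)"])
    fix c :: complex
    obtain r where r: "r > 0" "uniform_limit (ball (x + c *\<^sub>C h) r) f g sequentially"
      using lim by blast
    obtain d where d: "0 < d" "d * norm h < r"
      using small_multiple[OF r(1) norm_ge_zero] .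
    have ball: "x + b *\<^sub>C h \<in> ball (x + c *\<^sub>C h) r" if "b \<in> cball c d" for b
    proof -
      have "dist (x + c *\<^sub>C h) (x + b *\<^sub>C h) = cmod (c - b) * norm h"
        by (simp add: dist_norm norm_scaleC flip: scaleC_diff_left)
      also have "\<dots> \<le> d * norm h"
        using that by (intro mult_right_mono) (auto simp: dist_norm)
      finally show ?thesis using d by simp
    qed
    have "uniform_limit (cball c d) (\<lambda>n b. f n (x + b *\<^sub>C h)) (\<lambda>b. g (x + b *\<^sub>C h)) sequentially"
    proof (rule uniform_limitI)
      fix e :: real assume "0 < e"
      with r(2) have "\<forall>\<^sub>F n in sequentially. \<forall>y\<in>ball (x + c *\<^sub>C h) r. dist (f n y) (g y) < e"
        by (rule uniform_limitD)
      then show "\<forall>\<^sub>F n in sequentially. \<forall>b\<in>cball c d. dist (f n (x + b *\<^sub>C h)) (g (x + b *\<^sub>C h)) < e"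
      proof eventually_elim
        case (elim n)
        show ?case by (intro ballI bspec[OF elim] ball)
      qed
    qed
    with d show "\<exists>d>0. cball c d \<subseteq> UNIV \<and>
      uniform_limit (cball c d) (\<lambda>n b. f n (x + b *\<^sub>C h)) (\<lambda>b. g (x + b *\<^sub>C h)) sequentially"
      by auto
  qed (intro open_UNIV slice_holomorphic[OF f])+
  fix x0 :: 'a
  obtain r where r: "r > 0" "uniform_limit (ball x0 r) f g sequentially"
    using lim by blast
  let ?S = "ball x0 (r/2)"
  have close: "\<forall>\<^sub>F n in sequentially. \<forall>x\<in>?S. \<forall>h. cmod (dirderiv (f n) h x - dirderiv g h x) \<le> e * norm h"
    if "e > 0" for e
  proof -
    have "\<forall>\<^sub>F n in sequentially. \<forall>y\<in>ball x0 r. dist (f n y) (g y) < e * r / 2"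
      using r that by (intro uniform_limitD) auto
    then show ?thesis
    proof eventually_elim
      case (elim n)
      show ?case
      proof (intro ballI allI)
        have *: "cmod (f n y - g y) \<le> e * r / 2" if "y \<in> ball x0 r" for y
          using bspec[OF elim that] unfolding dist_norm by linarith
        fix x h assume "x \<in> ?S"
        then have "cmod (dirderiv (f n) h x - dirderiv g h x) \<le> 2 * (e * r / 2) / r * norm h"
          using r by (intro dirderiv_diff_bound slice slice_holomorphic[OF f] *)
        then show "cmod (dirderiv (f n) h x - dirderiv g h x) \<le> e * norm h"
          using r by simp
      qed
    qed
  qed
  have ptw: "(\<lambda>n. f n x) \<longlonglongrightarrow> g x" if "x \<in> ball x0 r" for x
    using tendsto_uniform_limitI[OF r(2) that] .
  \<comment> \<open>The theorem on differentiating a sequence returns some limit function on the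
    half ball; uniqueness of pointwise limits identifies it with \<open>g\<close>.\<close>
  have "\<exists>g'. \<forall>x\<in>?S. (\<lambda>n. f n x) \<longlonglongrightarrow> g' x \<and>
      (g' has_derivative (\<lambda>h. dirderiv g h x)) (at x within ?S)"
  proof (rule has_derivative_sequence[where f' = "\<lambda>n x h. dirderiv (f n) h x"])
    show "(f n has_derivative (\<lambda>h. dirderiv (f n) h x)) (at x within ?S)" for n x
      by (rule has_derivative_at_withinI[OF has_derivative_dirderiv(2)[OF f]])
    show "(\<lambda>n. f n x0) \<longlonglongrightarrow> g x0"
      using ptw[of x0] r by simp
    show "\<forall>\<^sub>F n in sequentially. \<forall>x\<in>?S. \<forall>h. cmod (dirderiv (f n) h x - dirderiv g h x) \<le> e * norm h"
      if "e > 0" for e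
      using that by (rule close)
    show "x0 \<in> ?S"
      using r by simp
  qed (rule convex_ball)
  then obtain g' where "\<forall>x\<in>?S. (\<lambda>n. f n x) \<longlonglongrightarrow> g' x \<and>
      (g' has_derivative (\<lambda>h. dirderiv g h x)) (at x within ?S)" ..
  note g' = bspec[OF this, THEN conjunct1] bspec[OF this, THEN conjunct2]
  have "g' x = g x" if "x \<in> ?S" for x
  proof -
    have "x \<in> ball x0 r"
      using that r by auto
    then show ?thesis
      using ptw g'(1)[OF that] LIMSEQ_unique by blast
  qed
  then have "(g has_derivative (\<lambda>h. dirderiv g h x0)) (at x0 within ?S)"
    using r by (intro has_derivative_transform[OF _ _ g'(2)]) auto
  then show "(g has_derivative (\<lambda>h. dirderiv g h x0)) (at x0)"
    using r by (subst (asm) at_within_open) auto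
  \<comment> \<open>\<open>has_derivative\<close> provides real linearity only. Complex linearity of
    the derivative of \<open>g\<close> is inherited from the \<open>f n\<close> by convergence in
    each fixed direction.\<close>
  have conv: "(\<lambda>n. dirderiv (f n) h x0) \<longlonglongrightarrow> dirderiv g h x0" for h
  proof (rule tendstoI)
    fix e :: real assume e: "0 < e"
    obtain b where b: "0 < b" "b * norm h < e"
      using small_multiple[OF e norm_ge_zero] .
    have "\<forall>\<^sub>F n in sequentially. \<forall>x\<in>?S. \<forall>h'. 
        cmod (dirderiv (f n) h' x - dirderiv g h' x) \<le> b * norm h'"
      using b by (intro close)
    then show "\<forall>\<^sub>F n in sequentially. dist (dirderiv (f n) h x0) (dirderiv g h x0) < e"
    proof eventually_elim
      case (elim n)
      then have "cmod (dirderiv (f n) h x0 - dirderiv g h x0) \<le> b * norm h"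
        using r by auto
      then show ?case
        using b by (simp add: dist_norm)
    qed
  qed
  have lin: "clinear_functional (\<lambda>h. dirderiv (f n) h x0)" for n
    by (rule has_derivative_dirderiv(1)[OF f])
  show "clinear_functional (\<lambda>h. dirderiv g h x0)"
    unfolding clinear_functional_iff
  proof (intro conjI allI)
    fix h k c
    have "(\<lambda>n. dirderiv (f n) (h + k) x0) \<longlonglongrightarrow> dirderiv g h x0 + dirderiv g k x0"
      using tendsto_add[OF conv[of h] conv[of k]] lin by (simp add: clinear_functional_iff)
    then show "dirderiv g (h + k) x0 = dirderiv g h x0 + dirderiv g k x0"
      using conv LIMSEQ_unique by blast
    have "(\<lambda>n. dirderiv (f n) (c *\<^sub>C h) x0) \<longlonglongrightarrow> c * dirderiv g h x0"
      using tendsto_mult_left[OF conv[of h], of c] lin by (simp add: clinear_functional_iff)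
    then show "dirderiv g (c *\<^sub>C h) x0 = c * dirderiv g h x0"
      using conv LIMSEQ_unique by blast
  qed
qed

text \<open>The difference quotients with step \<open>t n\<close> are holomorphic, and they converge
  locally uniformly: the remainder of order two is quadratic in the step, so division by the step
  leaves a bound proportional to \<open>cmod (t n)\<close>. The bound \<open>M\<close> near
  \<open>x0\<close> comes from continuity alone.\<close>

lemma holomorphic_fun_dirderiv:
  assumes f: "holomorphic_fun f"
  shows "holomorphic_fun (dirderiv f h)"
proof (rule holomorphic_fun_uniform_limit)
  define t :: "nat \<Rightarrow> complex" where "t n = of_real (inverse (real (Suc n)))" for n
  \<comment> \<open>The factor \<open>1\<close> in front of \<open>x\<close> gives the argument the
    shape required by \<open>holomorphic_fun_affine\<close>.\<close>
  let ?F = "\<lambda>n x. 1 / t n * (f (1 *\<^sub>C x + t n *\<^sub>C h) - f x)"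
  show "holomorphic_fun (?F n)" for n
    by (intro holomorphic_fun_cmult holomorphic_fun_diff holomorphic_fun_affine f)
  fix x0 :: 'a
  have "\<forall>\<^sub>F y in at x0. dist (f y) (f x0) < 1"
    using holomorphic_fun_isCont[OF f, of x0] unfolding isCont_def by (rule tendstoD) simp
  then obtain d where d: "d > 0" "\<And>y. y \<noteq> x0 \<Longrightarrow> dist y x0 < d \<Longrightarrow> dist (f y) (f x0) < 1"
    unfolding eventually_at by auto
  define M where "M = cmod (f x0) + 1"
  have M: "cmod (f y) \<le> M" if "dist y x0 < d" for y
  proof (cases "y = x0")
    case False
    then have "cmod (f y - f x0) < 1"
      using d that by (auto simp: dist_norm)
    then show ?thesis
      using norm_triangle_ineq2[of "f y" "f x0"] by (auto simp: M_def)
  qed (simp add: M_def)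
  \<comment> \<open>Discs of this radius in direction \<open>h\<close> around points of
    \<open>ball x0 (d/2)\<close> stay where \<open>M\<close> is a bound; the direction
    \<open>h = 0\<close> is included.\<close>
  obtain \<rho> where \<rho>: "0 < \<rho>" "\<rho> * norm h < d / 2"
    using small_multiple[of "d / 2" "norm h"] d by auto
  have t: "t n \<noteq> 0" "cmod (t n) = inverse (real (Suc n))" for n
    by (auto simp: t_def norm_inverse simp del: of_nat_Suc)
  have inv: "(\<lambda>n. inverse (real (Suc n))) \<longlonglongrightarrow> 0"
    by (rule LIMSEQ_inverse_real_of_nat)
  have "uniform_limit (ball x0 (d/2)) ?F (dirderiv f h) sequentially"
  proof (rule uniform_limit_dominated)
    show "(\<lambda>n. 2 * M / \<rho>\<^sup>2 * inverse (real (Suc n))) \<longlonglongrightarrow> 0"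
      using tendsto_mult_left[OF inv, of "2 * M / \<rho>\<^sup>2"] by simp
    have "\<forall>\<^sub>F n in sequentially. inverse (real (Suc n)) < \<rho> / 2"
      using \<rho> by (intro order_tendstoD(2)[OF inv]) auto
    then show "\<forall>\<^sub>F n in sequentially. \<forall>x\<in>ball x0 (d/2).
        dist (?F n x) (dirderiv f h x) \<le> 2 * M / \<rho>\<^sup>2 * inverse (real (Suc n))"
    proof eventually_elim
      case (elim n)
      show ?case
      proof
        fix x assume x: "x \<in> ball x0 (d/2)"
        let ?\<phi> = "\<lambda>c. f (x + c *\<^sub>C h)"
        have "cmod (?\<phi> (t n) - (\<Sum>m<2. (deriv ^^ m) ?\<phi> 0 / fact m * t n ^ m))
            \<le> 2 * M * (cmod (t n) / \<rho>) ^ 2"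
        proof (rule taylor_remainder_bound)
          show "cmod (?\<phi> c) \<le> M" if "cmod c = \<rho>" for c
          proof (rule M)
            have "dist (x + c *\<^sub>C h) x0 \<le> dist x x0 + norm (c *\<^sub>C h)"
              using norm_triangle_ineq[of "x - x0" "c *\<^sub>C h"] by (simp add: dist_norm algebra_simps)
            then show "dist (x + c *\<^sub>C h) x0 < d"
              using x \<rho> that by (simp add: norm_scaleC dist_commute)
          qed
        qed (use elim t \<rho> slice_holomorphic[OF f] in auto)
        also have "(\<Sum>m<2. (deriv ^^ m) ?\<phi> 0 / fact m * t n ^ m) = f x + dirderiv f h x * t n"
          by (simp add: numeral_2_eq_2 dirderiv_def)
        finally have "cmod (t n * (?F n x - dirderiv f h x)) \<le> 2 * M * (cmod (t n) / \<rho>) ^ 2"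
          using t(1)[of n] by (simp add: algebra_simps)
        then have "cmod (t n) * cmod (?F n x - dirderiv f h x)
            \<le> cmod (t n) * (2 * M / \<rho>\<^sup>2 * cmod (t n))"
          by (simp add: norm_mult power_divide power2_eq_square mult_ac)
        then have "cmod (?F n x - dirderiv f h x) \<le> 2 * M / \<rho>\<^sup>2 * cmod (t n)"
          by (rule mult_left_le_imp_le) (use t(1) in simp)
        then show "dist (?F n x) (dirderiv f h x) \<le> 2 * M / \<rho>\<^sup>2 * inverse (real (Suc n))"
          by (simp only: dist_norm t(2))
      qed
    qed
  qed
  then show "\<exists>r>0. uniform_limit (ball x0 r) ?F (dirderiv f h) sequentially"
    using d by (intro exI[of _ "d/2"]) auto
qed

section \<open>Topologies of directed families of seminorms\<close>

text \<open>Directedness makes the generating balls a base: a finite intersection of balls around a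
  point contains a ball of a single dominating seminorm. Both the increasing family on
  \<open>HW\<close> and the single norm on \<open>PW\<close> are instances.\<close>

locale directed_seminorms =
  fixes s :: "complex \<Rightarrow> 'f::ab_group_add \<Rightarrow> 'f" and V :: "'f set" and Q :: "('f \<Rightarrow> real) set"
  assumes vector_space: "vector_space s"
    and subspace: "module.subspace s V"
    and seminorm: "q \<in> Q \<Longrightarrow> seminorm_on s V q"
    and nonempty: "Q \<noteq> {}"
    and directed: "q \<in> Q \<Longrightarrow> q' \<in> Q \<Longrightarrow> \<exists>p\<in>Q. \<forall>x\<in>V. q x \<le> p x \<and> q' x \<le> p x"
begin

interpretation vector_space s by (rule vector_space)

lemma diff_mem: "x \<in> V \<Longrightarrow> y \<in> V \<Longrightarrow> x - y \<in> V"
  using subspace by (rule subspace_diff)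

lemma seminorm_zero:
  assumes "q \<in> Q"
  shows "q 0 = 0"
proof -
  have "q (s 0 0) = cmod 0 * q 0"
    using seminorm[OF assms] subspace_0[OF subspace] unfolding seminorm_on_def by blast
  then show ?thesis by simp
qed

lemma seminorm_diff_triangle:
  assumes "q \<in> Q" "x \<in> V" "y \<in> V" "z \<in> V"
  shows "q (x - z) \<le> q (x - y) + q (y - z)"
proof -
  have "q ((x - y) + (y - z)) \<le> q (x - y) + q (y - z)"
    using seminorm[OF assms(1)] assms diff_mem unfolding seminorm_on_def by blast
  then show ?thesis by simp
qed

lemma seminorm_ball_openin:
  assumes "q \<in> Q" "x \<in> V" "0 < e"
  shows "openin (seminorm_topology V Q) {y \<in> V. q (y - x) < e}"
  unfolding seminorm_topology_def by (rule topology_generated_by_Basis) (use assms in blast)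

text \<open>The forward direction is induction over the generated topology. Intersections use
  directedness and the smaller radius; a generating ball is neighbourhood of each of its points
  \<open>y\<close> by the triangle inequality, with the remaining radius
  \<open>e - q (y - x)\<close>.\<close>

lemma openin_seminorm_topology:
  "openin (seminorm_topology V Q) U \<longleftrightarrow>
    U \<subseteq> V \<and> (\<forall>x\<in>U. \<exists>q\<in>Q. \<exists>e>0. \<forall>y\<in>V. q (y - x) < e \<longrightarrow> y \<in> U)"
proof
  assume "openin (seminorm_topology V Q) U"
  then have "generate_topology_on {{y \<in> V. q (y - x) < e} | q x e. q \<in> Q \<and> x \<in> V \<and> 0 < e} U"
    unfolding seminorm_topology_def by (rule openin_topology_generated_by)
  then show "U \<subseteq> V \<and> (\<forall>x\<in>U. \<exists>q\<in>Q. \<exists>e>0. \<forall>y\<in>V. q (y - x) < e \<longrightarrow> y \<in> U)"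
  proof (induction rule: generate_topology_on.induct)
    case (Int a b)
    note a = Int.IH(1)[THEN conjunct1] Int.IH(1)[THEN conjunct2]
    note b = Int.IH(2)[THEN conjunct2]
    show ?case
    proof (intro conjI ballI)
      fix x assume x: "x \<in> a \<inter> b"
      then have xV: "x \<in> V" using a(1) by auto
      obtain q e where q: "q \<in> Q" "e > 0" "\<forall>y\<in>V. q (y - x) < e \<longrightarrow> y \<in> a"
        using bspec[OF a(2) IntD1[OF x]] by auto
      obtain q' e' where q': "q' \<in> Q" "e' > 0" "\<forall>y\<in>V. q' (y - x) < e' \<longrightarrow> y \<in> b"
        using bspec[OF b IntD2[OF x]] by auto
      obtain p where p: "p \<in> Q" "\<forall>x\<in>V. q x \<le> p x \<and> q' x \<le> p x"
        using directed[OF q(1) q'(1)] by auto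
      have "\<forall>y\<in>V. p (y - x) < min e e' \<longrightarrow> y \<in> a \<inter> b"
      proof (intro ballI impI)
        fix y assume y: "y \<in> V" "p (y - x) < min e e'"
        then have "q (y - x) < e" "q' (y - x) < e'"
          using bspec[OF p(2) diff_mem[OF y(1) xV]] by auto
        with y q(3) q'(3) show "y \<in> a \<inter> b" by auto
      qed
      moreover have "0 < min e e'"
        using q(2) q'(2) by simp
      ultimately show "\<exists>q\<in>Q. \<exists>e>0. \<forall>y\<in>V. q (y - x) < e \<longrightarrow> y \<in> a \<inter> b"
        using p(1) by (intro bexI[of _ p] exI[of _ "min e e'"] conjI)
    qed (use a in auto)
  next
    case (UN K)
    show ?case
    proof (intro conjI ballI)
      show "\<Union>K \<subseteq> V"
        using UN.IH by auto
      fix x assume "x \<in> \<Union>K"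
      then obtain k where k: "k \<in> K" "x \<in> k" by auto
      obtain q e where q: "q \<in> Q" "e > 0" "\<forall>y\<in>V. q (y - x) < e \<longrightarrow> y \<in> k"
        using bspec[OF UN.IH[OF k(1), THEN conjunct2] k(2)] by auto
      then show "\<exists>q\<in>Q. \<exists>e>0. \<forall>y\<in>V. q (y - x) < e \<longrightarrow> y \<in> \<Union>K"
        using k by (intro bexI[of _ q] exI[of _ e] conjI) auto
    qed
  next
    case (Basis b)
    then obtain q x e where b: "b = {y \<in> V. q (y - x) < e}" "q \<in> Q" "x \<in> V" "0 < e"
      by auto
    show ?case
    proof (intro conjI ballI)
      fix y assume y: "y \<in> b"
      then have y': "y \<in> V" "q (y - x) < e"
        unfolding b(1) by auto
      have "\<forall>z\<in>V. q (z - y) < e - q (y - x) \<longrightarrow> z \<in> b"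
      proof (intro ballI impI)
        fix z assume "z \<in> V" "q (z - y) < e - q (y - x)"
        with seminorm_diff_triangle[OF b(2) this(1) y'(1) b(3)] show "z \<in> b"
          unfolding b(1) by simp
      qed
      with y' b(2) show "\<exists>q\<in>Q. \<exists>e>0. \<forall>z\<in>V. q (z - y) < e \<longrightarrow> z \<in> b"
        by (intro bexI[of _ q] exI[of _ "e - q (y - x)"] conjI) auto
    qed (use b(1) in auto)
  qed auto
next
  assume U: "U \<subseteq> V \<and> (\<forall>x\<in>U. \<exists>q\<in>Q. \<exists>e>0. \<forall>y\<in>V. q (y - x) < e \<longrightarrow> y \<in> U)"
  show "openin (seminorm_topology V Q) U"
  proof (subst openin_subopen, intro ballI)
    fix x assume x: "x \<in> U"
    then have xV: "x \<in> V" using U by auto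
    obtain q e where q: "q \<in> Q" "e > 0" "\<forall>y\<in>V. q (y - x) < e \<longrightarrow> y \<in> U"
      using bspec[OF U[THEN conjunct2] x] by auto
    then show "\<exists>T. openin (seminorm_topology V Q) T \<and> x \<in> T \<and> T \<subseteq> U"
      using xV by (intro exI[of _ "{y \<in> V. q (y - x) < e}"] conjI seminorm_ball_openin)
        (auto simp: seminorm_zero)
  qed
qed

lemma openin_seminorm_topologyE:
  assumes "openin (seminorm_topology V Q) U" "x \<in> U"
  obtains q e where "q \<in> Q" "0 < e" "\<And>y. y \<in> V \<Longrightarrow> q (y - x) < e \<Longrightarrow> y \<in> U"
  using bspec[OF assms(1)[unfolded openin_seminorm_topology, THEN conjunct2] assms(2)] by auto

lemma openin_seminorm_topologyI:
  assumes "U \<subseteq> V"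
    "\<And>x. x \<in> U \<Longrightarrow> \<exists>q e. q \<in> Q \<and> 0 < e \<and> (\<forall>y\<in>V. q (y - x) < e \<longrightarrow> y \<in> U)"
  shows "openin (seminorm_topology V Q) U"
  unfolding openin_seminorm_topology
proof (intro conjI ballI)
  fix x assume "x \<in> U"
  from assms(2)[OF this] obtain q e
    where "q \<in> Q" "0 < e" "\<forall>y\<in>V. q (y - x) < e \<longrightarrow> y \<in> U" by auto
  then show "\<exists>q\<in>Q. \<exists>e>0. \<forall>y\<in>V. q (y - x) < e \<longrightarrow> y \<in> U"
    by (intro bexI[of _ q] exI[of _ e] conjI)
qed (rule assms(1))

lemma topspace_seminorm_topology: "topspace (seminorm_topology V Q) = V"
proof
  show "topspace (seminorm_topology V Q) \<subseteq> V"
    unfolding seminorm_topology_def topology_generated_by_topspace by auto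
  obtain q where "q \<in> Q"
    using nonempty by auto
  then have "openin (seminorm_topology V Q) V"
    by (intro openin_seminorm_topologyI exI[of _ q] exI[of _ 1]) auto
  then show "V \<subseteq> topspace (seminorm_topology V Q)"
    by (rule openin_subset)
qed

lemma limitin_seminorm_topology:
  assumes u: "\<And>n::nat. u n \<in> V"
  shows "limitin (seminorm_topology V Q) u l sequentially \<longleftrightarrow>
    l \<in> V \<and> (\<forall>q\<in>Q. (\<lambda>n. q (u n - l)) \<longlonglongrightarrow> 0)"
proof
  assume lim: "limitin (seminorm_topology V Q) u l sequentially"
  then have l: "l \<in> V"
    by (metis limitin_def topspace_seminorm_topology)
  have "(\<lambda>n. q (u n - l)) \<longlonglongrightarrow> 0" if q: "q \<in> Q" for q
  proof (rule tendstoI)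
    fix e :: real assume e: "0 < e"
    have "\<forall>\<^sub>F n in sequentially. u n \<in> {y \<in> V. q (y - l) < e}"
      using lim seminorm_ball_openin[OF q l e] l e seminorm_zero[OF q] unfolding limitin_def by auto
    then show "\<forall>\<^sub>F n in sequentially. dist (q (u n - l)) 0 < e"
    proof eventually_elim
      case (elim n)
      moreover have "0 \<le> q (u n - l)"
        using seminorm[OF q] diff_mem[OF u l] unfolding seminorm_on_def by blast
      ultimately show ?case by simp
    qed
  qed
  with l show "l \<in> V \<and> (\<forall>q\<in>Q. (\<lambda>n. q (u n - l)) \<longlonglongrightarrow> 0)" by blast
next
  assume l: "l \<in> V \<and> (\<forall>q\<in>Q. (\<lambda>n. q (u n - l)) \<longlonglongrightarrow> 0)"
  show "limitin (seminorm_topology V Q) u l sequentially"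
    unfolding limitin_def topspace_seminorm_topology
  proof (intro conjI allI impI)
    fix U assume "openin (seminorm_topology V Q) U \<and> l \<in> U"
    then obtain q e where q: "q \<in> Q" "e > 0" "\<And>y. y \<in> V \<Longrightarrow> q (y - l) < e \<Longrightarrow> y \<in> U"
      by (auto elim: openin_seminorm_topologyE)
    then have "\<forall>\<^sub>F n in sequentially. q (u n - l) < e"
      using l by (intro order_tendstoD(2)) auto
    then show "\<forall>\<^sub>F n in sequentially. u n \<in> U"
      by eventually_elim (use q u in auto)
  qed (use l in blast)
qed

text \<open>Preserving differences moves the bound from the origin to an arbitrary point. Everything
  is asked on \<open>V\<close> only, because a Schauder projection is defined through a description
  that is under control only there.\<close>

lemma continuous_map_seminorm_topology:
  assumes mem: "\<And>x. x \<in> V \<Longrightarrow> f x \<in> V"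
    and diff: "\<And>x y. x \<in> V \<Longrightarrow> y \<in> V \<Longrightarrow> f (x - y) = f x - f y"
    and bound: "\<And>q. q \<in> Q \<Longrightarrow> \<exists>p\<in>Q. \<exists>C>0. \<forall>x\<in>V. q (f x) \<le> C * p x"
  shows "continuous_map (seminorm_topology V Q) (seminorm_topology V Q) f"
  unfolding continuous_map topspace_seminorm_topology
proof (intro conjI allI impI)
  fix U assume U: "openin (seminorm_topology V Q) U"
  show "openin (seminorm_topology V Q) {x \<in> V. f x \<in> U}"
  proof (rule openin_seminorm_topologyI)
    fix x assume "x \<in> {x \<in> V. f x \<in> U}"
    then have x: "x \<in> V" "f x \<in> U" by auto
    obtain q e where q: "q \<in> Q" "e > 0" "\<And>y. y \<in> V \<Longrightarrow> q (y - f x) < e \<Longrightarrow> y \<in> U"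
      using openin_seminorm_topologyE[OF U x(2)] by metis
    obtain p C where p: "p \<in> Q" "C > 0" "\<forall>x\<in>V. q (f x) \<le> C * p x"
      using bound[OF q(1)] by auto
    have "f y \<in> U" if y: "y \<in> V" "p (y - x) < e / C" for y
    proof -
      have "q (f y - f x) \<le> C * p (y - x)"
        using bspec[OF p(3) diff_mem[OF y(1) x(1)]] diff[OF y(1) x(1)] by simp
      also have "\<dots> < e"
        using y p(2) by (simp add: field_simps)
      finally show ?thesis
        by (rule q(3)[OF mem[OF y(1)]])
    qed
    then show "\<exists>p e. p \<in> Q \<and> 0 < e \<and> (\<forall>y\<in>V. p (y - x) < e \<longrightarrow> y \<in> {x \<in> V. f x \<in> U})"
      using p(1,2) q(2) by (intro exI[of _ p] exI[of _ "e / C"]) auto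
  qed auto
qed (use mem in auto)

lemma directed_seminorms_singleton:
  assumes "q \<in> Q" "F \<subseteq> V" "module.subspace s F"
  shows "directed_seminorms s F {q}"
proof
  show "seminorm_on s F q'" if "q' \<in> {q}" for q'
    using that seminorm[OF assms(1)] assms(2) unfolding seminorm_on_def by blast
qed (use assms in \<open>auto\<close>)

text \<open>A relatively open set is the trace of the union of ambient \<open>q\<close>-balls around
  its points, with radii chosen point by point. Conversely, \<open>bound\<close> places a
  \<open>q\<close>-ball of radius \<open>e / C\<close> inside any given \<open>p\<close>-ball on
  \<open>F\<close>.\<close>

lemma subtopology_seminorm_topology:
  assumes q: "q \<in> Q" and F: "F \<subseteq> V" "module.subspace s F"
    and bound: "\<And>p. p \<in> Q \<Longrightarrow> \<exists>C>0. \<forall>x\<in>F. p x \<le> C * q x"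
  shows "seminorm_topology F {q} = subtopology (seminorm_topology V Q) F"
proof -
  interpret F: directed_seminorms s F "{q}"
    using assms by (intro directed_seminorms_singleton)
  show ?thesis
    unfolding topology_eq openin_subtopology
  proof (intro allI iffI)
    fix S assume S: "openin (seminorm_topology F {q}) S"
    have SF: "S \<subseteq> F"
      using openin_subset[OF S] F.topspace_seminorm_topology by simp
    have "\<forall>x\<in>S. \<exists>e. 0 < e \<and> (\<forall>y\<in>F. q (y - x) < e \<longrightarrow> y \<in> S)"
    proof
      fix x assume "x \<in> S"
      then obtain p e where "p \<in> {q}" "0 < e" "\<And>y. y \<in> F \<Longrightarrow> p (y - x) < e \<Longrightarrow> y \<in> S"
        using F.openin_seminorm_topologyE[OF S] by metis
      then show "\<exists>e. 0 < e \<and> (\<forall>y\<in>F. q (y - x) < e \<longrightarrow> y \<in> S)"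
        by (intro exI[of _ e] conjI ballI impI) auto
    qed
    from bchoice[OF this] obtain e
      where "\<forall>x\<in>S. 0 < e x \<and> (\<forall>y\<in>F. q (y - x) < e x \<longrightarrow> y \<in> S)" ..
    note e = bspec[OF this, THEN conjunct1] bspec[OF this, THEN conjunct2, rule_format]
    let ?U = "\<Union>x\<in>S. {y \<in> V. q (y - x) < e x}"
    have "openin (seminorm_topology V Q) {y \<in> V. q (y - x) < e x}" if "x \<in> S" for x
    proof (rule seminorm_ball_openin[OF q _ e(1)[OF that]])
      show "x \<in> V"
        using SF F(1) that by auto
    qed
    then have "openin (seminorm_topology V Q) ?U"
      by (intro openin_Union) auto
    moreover have "S \<subseteq> ?U \<inter> F"
    proof
      fix x assume x: "x \<in> S"
      then have "x \<in> {y \<in> V. q (y - x) < e x}"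
        using SF F(1) e(1) by (auto simp: seminorm_zero[OF q])
      then show "x \<in> ?U \<inter> F"
        using SF x by (intro IntI UN_I[OF x]) auto
    qed
    moreover have "?U \<inter> F \<subseteq> S"
      using e(2) by auto
    ultimately show "\<exists>T. openin (seminorm_topology V Q) T \<and> S = T \<inter> F"
      by (intro exI[of _ ?U] conjI equalityI)
  next
    fix S assume "\<exists>T. openin (seminorm_topology V Q) T \<and> S = T \<inter> F"
    then obtain T where T: "openin (seminorm_topology V Q) T" "S = T \<inter> F" by auto
    show "openin (seminorm_topology F {q}) S"
    proof (rule F.openin_seminorm_topologyI)
      fix x assume "x \<in> S"
      then have x: "x \<in> T" "x \<in> F"
        using T(2) by auto
      obtain p e where p: "p \<in> Q" "e > 0" "\<And>y. y \<in> V \<Longrightarrow> p (y - x) < e \<Longrightarrow> y \<in> T"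
        using openin_seminorm_topologyE[OF T(1) x(1)] by metis
      obtain C where C: "C > 0" "\<forall>x\<in>F. p x \<le> C * q x"
        using bound[OF p(1)] by auto
      have "y \<in> S" if y: "y \<in> F" "q (y - x) < e / C" for y
      proof -
        have "p (y - x) \<le> C * q (y - x)"
          by (rule bspec[OF C(2) F.diff_mem[OF y(1) x(2)]])
        also have "\<dots> < e"
          using y C(1) by (simp add: field_simps)
        finally show ?thesis
          using p(3)[of y] y(1) F(1) T(2) by auto
      qed
      then show "\<exists>p e. p \<in> {q} \<and> 0 < e \<and> (\<forall>y\<in>F. p (y - x) < e \<longrightarrow> y \<in> S)"
        using p(2) C(1) by (intro exI[of _ q] exI[of _ "e / C"]) auto
    qed (use T in auto)
  qed
qed

end

section \<open>Taylor components\<close>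

lemma dirderiv_add:
  assumes "holomorphic_fun f" "holomorphic_fun g"
  shows "dirderiv (\<lambda>x. f x + g x) h = (\<lambda>x. dirderiv f h x + dirderiv g h x)"
proof
  fix x
  show "dirderiv (\<lambda>x. f x + g x) h x = dirderiv f h x + dirderiv g h x"
    using DERIV_add[OF slice_DERIV[OF assms(1), of x h 0] slice_DERIV[OF assms(2), of x h 0]]
    unfolding dirderiv_def[of "\<lambda>x. f x + g x"] by (intro DERIV_imp_deriv) simp
qed

lemma dirderiv_cmult:
  assumes "holomorphic_fun f"
  shows "dirderiv (\<lambda>x. c * f x) h = (\<lambda>x. c * dirderiv f h x)"
proof
  fix x
  show "dirderiv (\<lambda>x. c * f x) h x = c * dirderiv f h x"
    using DERIV_cmult[OF slice_DERIV[OF assms(1), of x h 0], of c]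
    unfolding dirderiv_def[of "\<lambda>x. c * f x"] by (intro DERIV_imp_deriv) simp
qed

lemma holomorphic_fun_foldl_dirderiv:
  "holomorphic_fun f \<Longrightarrow> holomorphic_fun (foldl dirderiv f hs)"
  by (induction hs arbitrary: f) (auto intro: holomorphic_fun_dirderiv)

lemma foldl_dirderiv_add:
  "holomorphic_fun f \<Longrightarrow> holomorphic_fun g \<Longrightarrow>
    foldl dirderiv (\<lambda>x. f x + g x) hs = (\<lambda>x. foldl dirderiv f hs x + foldl dirderiv g hs x)"
  by (induction hs arbitrary: f g) (auto simp: dirderiv_add holomorphic_fun_dirderiv)

lemma foldl_dirderiv_cmult:
  "holomorphic_fun f \<Longrightarrow>
    foldl dirderiv (\<lambda>x. c * f x) hs = (\<lambda>x. c * foldl dirderiv f hs x)"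
  by (induction hs arbitrary: f) (auto simp: dirderiv_cmult holomorphic_fun_dirderiv)

text \<open>Splitting the list at slot \<open>i\<close> shows \<open>dirderiv g u\<close> with
  \<open>g\<close> already differentiated along the earlier directions: this is linear in
  \<open>u\<close> because the Frechet derivative is, and the later derivatives act linearly on
  functions. No symmetry of mixed derivatives enters. The factor \<open>a\<close> makes room for
  \<open>1 / fact n\<close>.\<close>

lemma multilinear_form_foldl_dirderiv:
  assumes f: "holomorphic_fun f"
  shows "multilinear_form n (\<lambda>hs. a * foldl dirderiv f hs x)"
  unfolding multilinear_form_def
proof (intro allI impI)
  fix hs :: "'a list" and i assume i: "length hs = n \<and> i < n"
  define g where "g = foldl dirderiv f (take i hs)"
  have g: "holomorphic_fun g"
    unfolding g_def using f by (rule holomorphic_fun_foldl_dirderiv)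
  have *: "foldl dirderiv f (hs[i := u]) = foldl dirderiv (dirderiv g u) (drop (Suc i) hs)" for u
    using i by (simp add: upd_conv_take_nth_drop g_def)
  have "dirderiv g (u + v) = (\<lambda>x. dirderiv g u x + dirderiv g v x)"
    "dirderiv g (c *\<^sub>C u) = (\<lambda>x. c * dirderiv g u x)" for u v c
    using has_derivative_dirderiv(1)[OF g] by (auto simp: clinear_functional_iff)
  then show "clinear_functional (\<lambda>u. a * foldl dirderiv f (hs[i := u]) x)"
    unfolding clinear_functional_iff *
    by (simp add: foldl_dirderiv_add foldl_dirderiv_cmult holomorphic_fun_dirderiv g distrib_left)
qed

lemma higher_deriv_slice:
  assumes "holomorphic_fun f"
  shows "(deriv ^^ n) (\<lambda>c. f (x + c *\<^sub>C h)) =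
    (\<lambda>c. foldl dirderiv f (replicate n h) (x + c *\<^sub>C h))"
  using assms
proof (induction n arbitrary: f)
  case (Suc n)
  then show ?case
    using Suc.IH[OF holomorphic_fun_dirderiv[OF Suc.prems]]
    by (simp add: funpow_Suc_right deriv_slice del: funpow.simps)
qed simp

definition taylor_component :: "nat \<Rightarrow> ('a::complex_banach \<Rightarrow> complex) \<Rightarrow> 'a \<Rightarrow> complex"
  where "taylor_component n f x = (deriv ^^ n) (\<lambda>c. f (c *\<^sub>C x)) 0 / fact n"

lemma homogeneous_polynomial_taylor_component:
  assumes "holomorphic_fun f"
  shows "homogeneous_polynomial n (taylor_component n f)"
  unfolding homogeneous_polynomial_def
proof (intro exI conjI allI)
  show "multilinear_form n (\<lambda>hs. (1 / fact n) * foldl dirderiv f hs 0)"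
    using assms by (rule multilinear_form_foldl_dirderiv)
  show "taylor_component n f x = (1 / fact n) * foldl dirderiv f (replicate n x) 0" for x
    using higher_deriv_slice[OF assms, of n 0 x] by (simp add: taylor_component_def)
qed

section \<open>Uniqueness of Taylor coefficients and its consequences\<close>

lemma taylor_component_sums:
  assumes "holomorphic_fun f"
  shows "(\<lambda>n. taylor_component n f x * c ^ n) sums f (c *\<^sub>C x)"
  using holomorphic_power_series[of "\<lambda>c. f (c *\<^sub>C x)" 0 "cmod c + 1" c] slice0_holomorphic[OF assms]
  by (auto simp: taylor_component_def intro: holomorphic_on_subset)

text \<open>The tool behind every identification of a component: homogeneity, compatibility with
  differences and uniqueness of the expansion all follow by exhibiting a power series that sums to
  the slice on the whole plane.\<close>

lemma taylor_component_eqI: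
  assumes "\<And>c. (\<lambda>n. a n * c ^ n) sums f (c *\<^sub>C x)"
  shows "taylor_component n f x = a n"
  unfolding taylor_component_def using assms by (rule power_series_coefficient)

lemma taylor_component_homogeneous:
  assumes "holomorphic_fun f"
  shows "taylor_component n f (c *\<^sub>C x) = c ^ n * taylor_component n f x"
proof (rule taylor_component_eqI)
  show "(\<lambda>n. c ^ n * taylor_component n f x * b ^ n) sums f (b *\<^sub>C c *\<^sub>C x)" for b
    using taylor_component_sums[OF assms, of x "b * c"]
    by (simp add: scaleC_scaleC power_mult_distrib mult_ac)
qed

lemma taylor_component_diff:
  assumes "holomorphic_fun f" "holomorphic_fun g"
  shows "taylor_component n (f - g) x = taylor_component n f x - taylor_component n g x"
proof (rule taylor_component_eqI)
  show "(\<lambda>n. (taylor_component n f x - taylor_component n g x) * c ^ n) sums (f - g) (c *\<^sub>C x)" for c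
    using sums_diff[OF taylor_component_sums[OF assms(1)] taylor_component_sums[OF assms(2)]]
    by (simp add: left_diff_distrib)
qed

text \<open>The slice through \<open>x\<close> is a monomial, so its series has a single
  coefficient. This later shows that homogeneous members of \<open>HW\<close> are
  polynomials.\<close>

lemma taylor_component_id:
  assumes "\<And>c. f (c *\<^sub>C x) = c ^ n * f x"
  shows "taylor_component n f x = f x"
proof -
  have "taylor_component n f x = (\<lambda>m. if m = n then f x else 0) n"
  proof (rule taylor_component_eqI[where a = "\<lambda>m. if m = n then f x else 0"])
    fix c
    have "(\<lambda>m. (if m = n then f x else 0) * c ^ m) = (\<lambda>m. if m = n then f x * c ^ m else 0)"
      by auto
    then show "(\<lambda>m. (if m = n then f x else 0) * c ^ m) sums f (c *\<^sub>C x)"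
      using sums_single[of n "\<lambda>m. f x * c ^ m"] assms[of c] by (simp add: mult.commute)
  qed
  then show ?thesis by simp
qed

text \<open>
  Having found the components below \<open>n\<close>, the \<open>n\<close>-th one is the limit of
  \<open>(f (t x) - (\<Sum>m<n. t ^ m * f\<^sub>m x)) / t ^ n\<close> as \<open>t \<rightarrow> 0\<close>, uniformly on bounded sets.
\<close>

lemma holomorphic_fun_taylor_component:
  fixes f :: "'a::complex_banach \<Rightarrow> complex"
  assumes f: "holomorphic_fun f" and bdd: "\<And>r. \<exists>M. \<forall>x. norm x \<le> r \<longrightarrow> cmod (f x) \<le> M"
  shows "holomorphic_fun (taylor_component n f)"
proof (induction n rule: less_induct)
  case (less n)
  define t :: "nat \<Rightarrow> complex" where "t N = of_real (inverse (real (Suc N)))" for N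
  have t: "t N \<noteq> 0" "cmod (t N) = inverse (real (Suc N))" for N
    by (auto simp: t_def norm_inverse simp del: of_nat_Suc)
  then have t1: "cmod (t N) \<le> 1" for N
    by (simp add: inverse_le_1_iff)
  \<comment> \<open>The summand \<open>0\<close> gives the argument of \<open>f\<close> the shape
    required by \<open>holomorphic_fun_affine\<close>.\<close>
  let ?F = "\<lambda>N x. 1 / t N ^ n * (f (t N *\<^sub>C x + 0) - (\<Sum>m<n. t N ^ m * taylor_component m f x))"
  show ?case
  proof (rule holomorphic_fun_uniform_limit)
    show "holomorphic_fun (?F N)" for N
      using less.IH f
      by (intro holomorphic_fun_cmult holomorphic_fun_diff holomorphic_fun_affine
          holomorphic_fun_sum) auto
    fix x0 :: 'a
    \<comment> \<open>Points of \<open>ball x0 1\<close> have norm at most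
      \<open>norm x0 + 1\<close>, and their slices are estimated on the circle
      \<open>cmod c = 2\<close>.\<close>
    obtain M where M: "\<And>x. norm x \<le> 2 * (norm x0 + 1) \<Longrightarrow> cmod (f x) \<le> M"
      using bdd by blast
    have "uniform_limit (ball x0 1) ?F (taylor_component n f) sequentially"
    proof (rule uniform_limit_dominated)
      show "(\<lambda>N. M * inverse (real (Suc N))) \<longlonglongrightarrow> 0"
        using tendsto_mult_left[OF LIMSEQ_inverse_real_of_nat, of M] by simp
      show "\<forall>\<^sub>F N in sequentially. \<forall>x\<in>ball x0 1.
          dist (?F N x) (taylor_component n f x) \<le> M * inverse (real (Suc N))"
      proof (intro always_eventually allI ballI)
        fix N x assume "x \<in> ball x0 1"
        then have x: "norm x \<le> norm x0 + 1"
          using norm_triangle_ineq2[of x x0] by (simp add: dist_norm norm_minus_commute)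
        let ?\<phi> = "\<lambda>c. f (c *\<^sub>C x)"
        have M0: "cmod (?\<phi> c) \<le> M" if "cmod c = 2" for c
          using x that by (intro M) (simp add: norm_scaleC)
        then have "0 \<le> M"
          by (metis norm_ge_zero norm_numeral order_trans)
        \<comment> \<open>The remainder is taken one order beyond \<open>n\<close>: after division
          by \<open>t N ^ n\<close> the term of index \<open>n\<close> is the component itself, and
          one factor \<open>t N\<close> is left to make the error vanish.\<close>
        have "cmod (?\<phi> (t N) - (\<Sum>m<Suc n. (deriv ^^ m) ?\<phi> 0 / fact m * t N ^ m))
            \<le> 2 * M * (cmod (t N) / 2) ^ Suc n"
          using t1[of N] M0 by (intro taylor_remainder_bound slice0_holomorphic f) auto
        also have "?\<phi> (t N) - (\<Sum>m<Suc n. (deriv ^^ m) ?\<phi> 0 / fact m * t N ^ m)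
            = t N ^ n * (?F N x - taylor_component n f x)"
          using t(1)[of N] by (simp add: taylor_component_def algebra_simps)
        also have "2 * M * (cmod (t N) / 2) ^ Suc n = cmod (t N) ^ n * (M * cmod (t N) / 2 ^ n)"
          by (simp add: power_divide)
        also have "\<dots> \<le> cmod (t N) ^ n * (M * cmod (t N) / 1)"
          using \<open>0 \<le> M\<close> by (intro mult_left_mono divide_left_mono) auto
        finally show "dist (?F N x) (taylor_component n f x) \<le> M * inverse (real (Suc N))"
          using t[of N] by (simp add: norm_mult norm_power dist_norm mult_le_cancel_left_pos del: of_nat_Suc)
      qed
    qed
    then show "\<exists>r>0. uniform_limit (ball x0 r) ?F (taylor_component n f) sequentially"
      by (intro exI[of _ 1]) auto
  qed
qed

text \<open>The slots are rescaled one at a time: the induction counts the leading slots that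
  already hold \<open>c *\<^sub>C x\<close>, and linearity in slot \<open>k\<close> extracts one
  more factor \<open>c\<close>.\<close>

lemma homogeneous_polynomial_scaleC:
  assumes "homogeneous_polynomial n P"
  shows "P (c *\<^sub>C x) = c ^ n * P x"
proof -
  obtain A where A: "multilinear_form n A" "\<And>x. P x = A (replicate n x)"
    using assms unfolding homogeneous_polynomial_def by blast
  have "A (replicate k (c *\<^sub>C x) @ replicate (n - k) x) = c ^ k * A (replicate n x)" if "k \<le> n" for k
    using that
  proof (induction k)
    case (Suc k)
    let ?xs = "replicate k (c *\<^sub>C x) @ replicate (n - k) x"
    have n: "n - k = Suc (n - Suc k)"
      using Suc.prems by simp
    have upd: "?xs[k := u] = replicate k (c *\<^sub>C x) @ u # replicate (n - Suc k) x" for u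
      unfolding n by (simp add: list_update_append)
    have "clinear_functional (\<lambda>u. A (?xs[k := u]))"
      using A(1) Suc.prems unfolding multilinear_form_def by simp
    then have "A (?xs[k := c *\<^sub>C x]) = c * A (?xs[k := x])"
      unfolding clinear_functional_iff by blast
    moreover have "?xs[k := x] = ?xs"
      by (simp add: n list_update_append)
    moreover have "?xs[k := c *\<^sub>C x] = replicate (Suc k) (c *\<^sub>C x) @ replicate (n - Suc k) x"
      unfolding upd by (simp add: replicate_app_Cons_same)
    ultimately show ?case
      using Suc by simp
  qed simp
  from this[of n] show ?thesis
    by (simp add: A(2))
qed

section \<open>Weighted spaces of entire functions\<close>

lemma sum_fun_apply: "(\<Sum>i\<in>I. f i) x = (\<Sum>i\<in>I. f i x)"
  for f :: "'i \<Rightarrow> 'a \<Rightarrow> 'b::comm_monoid_add"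
  by (induction I rule: infinite_finite_induct) auto

lemma vector_space_cscale: "vector_space cscale"
  by unfold_locales (auto simp: cscale_def fun_eq_iff algebra_simps)

lemma subspace_cscaleI:
  assumes "0 \<in> V" "\<And>f g. f \<in> V \<Longrightarrow> g \<in> V \<Longrightarrow> f + g \<in> V" "\<And>c f. f \<in> V \<Longrightarrow> cscale c f \<in> V"
  shows "module.subspace cscale V"
proof -
  interpret vector_space cscale by (rule vector_space_cscale)
  show ?thesis using assms by (rule subspaceI)
qed

lemma weighted_norm_le:
  assumes "\<And>x. w x * cmod (f x) \<le> B"
  shows "weighted_norm w f \<le> B"
  unfolding weighted_norm_def using assms by (intro cSUP_least) auto

lemma weighted_norm_minus_commute: "weighted_norm w (f - g) = weighted_norm w (g - f)"
  by (simp add: weighted_norm_def norm_minus_commute)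

lemma HW_iff:
  "f \<in> HW \<eta> \<longleftrightarrow> holomorphic_fun f \<and> (\<forall>n\<ge>1. \<exists>B. \<forall>x. weight \<eta> n x * cmod (f x) \<le> B)"
  by (auto simp: HW_def bdd_above_def)

lemma HW_I:
  assumes "holomorphic_fun f" "\<And>n x. n \<ge> 1 \<Longrightarrow> weight \<eta> n x * cmod (f x) \<le> B n"
  shows "f \<in> HW \<eta>"
  using assms unfolding HW_iff by auto

lemma HW_holomorphic: "f \<in> HW \<eta> \<Longrightarrow> holomorphic_fun f"
  by (simp add: HW_def)

lemma HW_bound:
  assumes "f \<in> HW \<eta>" "n \<ge> 1"
  shows "weight \<eta> n x * cmod (f x) \<le> weighted_norm (weight \<eta> n) f"
  unfolding weighted_norm_def using assms by (intro cSUP_upper) (auto simp: HW_def)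

locale decreasing_weight =
  fixes \<eta> :: "real \<Rightarrow> real"
  assumes pos: "0 \<le> t \<Longrightarrow> 0 < \<eta> t"
    and decreasing: "0 \<le> s \<Longrightarrow> s \<le> t \<Longrightarrow> \<eta> t \<le> \<eta> s"
begin

abbreviation wnorm :: "nat \<Rightarrow> ('a::complex_banach \<Rightarrow> complex) \<Rightarrow> real"
  where "wnorm n \<equiv> weighted_norm (weight \<eta> n)"

abbreviation wnorms :: "(('a::complex_banach \<Rightarrow> complex) \<Rightarrow> real) set"
  where "wnorms \<equiv> {wnorm n | n. n \<ge> 1}"

lemma weight_pos: "0 < weight \<eta> n x"
  by (simp add: weight_def pos)

lemma weight_mono:
  assumes "1 \<le> m" "m \<le> n"
  shows "weight \<eta> m x \<le> weight \<eta> n x"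
  unfolding weight_def using assms by (intro decreasing) (auto intro!: divide_left_mono)

lemma weight_antimono_norm:
  assumes "norm x \<le> r"
  shows "\<eta> r \<le> weight \<eta> 1 x"
  unfolding weight_def using assms by (intro decreasing) auto

lemma wnorm_nonneg:
  fixes f :: "'a::complex_banach \<Rightarrow> complex"
  assumes "f \<in> HW \<eta>" "n \<ge> 1"
  shows "0 \<le> wnorm n f"
proof -
  have "0 \<le> weight \<eta> n (0::'a) * cmod (f 0)"
    by (intro mult_nonneg_nonneg less_imp_le[OF weight_pos]) simp
  also have "\<dots> \<le> wnorm n f"
    using assms by (rule HW_bound)
  finally show ?thesis .
qed

lemma HW_norm_le:
  assumes "f \<in> HW \<eta>" "n \<ge> 1"
  shows "cmod (f x) \<le> wnorm n f / weight \<eta> n x"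
  using HW_bound[OF assms, of x] weight_pos[of n x] by (simp add: field_simps)

text \<open>On the ball of radius \<open>r\<close> the weight is bounded below by
  \<open>\<eta> r\<close>, which is positive. This supplies the boundedness assumption of
  \<open>holomorphic_fun_taylor_component\<close>.\<close>

lemma HW_bounded_on_bounded:
  fixes f :: "'a::complex_banach \<Rightarrow> complex"
  assumes "f \<in> HW \<eta>"
  shows "\<exists>M. \<forall>x. norm x \<le> r \<longrightarrow> cmod (f x) \<le> M"
proof (intro exI allI impI)
  fix x :: 'a assume x: "norm x \<le> r"
  then have "0 < \<eta> r"
    by (intro pos) (use norm_ge_zero order_trans in blast)
  moreover have "\<eta> r * cmod (f x) \<le> weight \<eta> 1 x * cmod (f x)"
    using weight_antimono_norm[OF x] by (rule mult_right_mono) simp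
  moreover have "weight \<eta> 1 x * cmod (f x) \<le> wnorm 1 f"
    using assms by (rule HW_bound) simp
  ultimately show "cmod (f x) \<le> wnorm 1 f / \<eta> r"
    by (simp add: pos_le_divide_eq mult.commute)
qed

section \<open>Linear structure and seminorms of \<open>HW\<close>\<close>

lemma weighted_add_le:
  assumes "f \<in> HW \<eta>" "g \<in> HW \<eta>" "n \<ge> 1"
  shows "weight \<eta> n x * cmod ((f + g) x) \<le> wnorm n f + wnorm n g"
proof -
  have "weight \<eta> n x * cmod ((f + g) x) \<le> weight \<eta> n x * (cmod (f x) + cmod (g x))"
    using weight_pos[of n x] by (intro mult_left_mono) (auto intro: norm_triangle_ineq)
  also have "\<dots> \<le> wnorm n f + wnorm n g"
    unfolding distrib_left using assms by (intro add_mono HW_bound)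
  finally show ?thesis .
qed

lemma weighted_cscale_le:
  assumes "f \<in> HW \<eta>" "n \<ge> 1"
  shows "weight \<eta> n x * cmod (cscale c f x) \<le> cmod c * wnorm n f"
proof -
  have "weight \<eta> n x * cmod (cscale c f x) = cmod c * (weight \<eta> n x * cmod (f x))"
    by (simp add: cscale_def norm_mult)
  also have "\<dots> \<le> cmod c * wnorm n f"
    using assms by (intro mult_left_mono HW_bound) auto
  finally show ?thesis .
qed

lemma subspace_HW: "module.subspace cscale (HW \<eta> :: ('a::complex_banach \<Rightarrow> complex) set)"
proof (rule subspace_cscaleI)
  show "(0 :: 'a \<Rightarrow> complex) \<in> HW \<eta>"
    using holomorphic_fun_const[of 0] by (intro HW_I[where B = "\<lambda>_. 0"]) (auto simp: zero_fun_def)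
  show "f + g \<in> HW \<eta>" if "f \<in> HW \<eta>" "g \<in> HW \<eta>" for f g :: "'a \<Rightarrow> complex"
  proof (rule HW_I)
    show "holomorphic_fun (f + g)"
      using holomorphic_fun_add[OF that[THEN HW_holomorphic]] by (simp add: plus_fun_def)
  qed (rule weighted_add_le[OF that])
  show "cscale c f \<in> HW \<eta>" if "f \<in> HW \<eta>" for c and f :: "'a \<Rightarrow> complex"
  proof (rule HW_I)
    show "holomorphic_fun (cscale c f)"
      unfolding cscale_def using that by (intro holomorphic_fun_cmult HW_holomorphic)
  qed (rule weighted_cscale_le[OF that])
qed

lemma seminorm_on_HW:
  assumes n: "n \<ge> 1"
  shows "seminorm_on cscale (HW \<eta> :: ('a::complex_banach \<Rightarrow> complex) set) (wnorm n)"
  unfolding seminorm_on_def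
proof (intro conjI ballI allI)
  fix f g :: "'a \<Rightarrow> complex" and c
  assume f: "f \<in> HW \<eta>"
  show "0 \<le> wnorm n f"
    using f n by (rule wnorm_nonneg)
  show "wnorm n (f + g) \<le> wnorm n f + wnorm n g" if "g \<in> HW \<eta>"
    using f that n by (intro weighted_norm_le weighted_add_le)
  have cf: "cscale c f \<in> HW \<eta>"
  proof -
    interpret vector_space "cscale :: _ \<Rightarrow> _ \<Rightarrow> 'a \<Rightarrow> complex" by (rule vector_space_cscale)
    show ?thesis using subspace_HW f by (rule subspace_scale)
  qed
  show "wnorm n (cscale c f) = cmod c * wnorm n f"
  proof (rule antisym)
    show "wnorm n (cscale c f) \<le> cmod c * wnorm n f"
      using f n by (intro weighted_norm_le weighted_cscale_le)
    \<comment> \<open>For nonzero \<open>c\<close> the reverse inequality is the same estimate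
      applied to \<open>cscale c f\<close> and the scalar \<open>inverse c\<close>.\<close>
    show "cmod c * wnorm n f \<le> wnorm n (cscale c f)"
    proof (cases "c = 0")
      case True
      then show ?thesis
        using wnorm_nonneg[OF cf n] by simp
    next
      case False
      then have "wnorm n f = wnorm n (cscale (inverse c) (cscale c f))"
        by (simp add: cscale_def flip: mult.assoc)
      also have "\<dots> \<le> cmod (inverse c) * wnorm n (cscale c f)"
        using cf n by (intro weighted_norm_le weighted_cscale_le)
      finally have "cmod c * wnorm n f \<le> cmod c * (cmod (inverse c) * wnorm n (cscale c f))"
        by (rule mult_left_mono) simp
      also have "\<dots> = wnorm n (cscale c f)"
        using False by (simp add: norm_inverse)
      finally show ?thesis .
    qed
  qed
qed

lemma wnorm_mono:
  assumes "1 \<le> m" "m \<le> n" "f \<in> HW \<eta>"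
  shows "wnorm m f \<le> wnorm n f"
proof (rule weighted_norm_le)
  fix x
  have "weight \<eta> m x * cmod (f x) \<le> weight \<eta> n x * cmod (f x)"
    using assms by (intro mult_right_mono weight_mono) auto
  also have "\<dots> \<le> wnorm n f"
    using assms by (intro HW_bound) auto
  finally show "weight \<eta> m x * cmod (f x) \<le> wnorm n f" .
qed

lemma directed_seminorms_HW:
  "directed_seminorms cscale (HW \<eta> :: ('a::complex_banach \<Rightarrow> complex) set) wnorms"
proof (rule directed_seminorms.intro)
  show "seminorm_on cscale (HW \<eta> :: ('a \<Rightarrow> complex) set) q" if "q \<in> wnorms" for q
    using that seminorm_on_HW by auto
  fix q q' :: "('a \<Rightarrow> complex) \<Rightarrow> real"
  assume "q \<in> wnorms" "q' \<in> wnorms"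
  then obtain m n where mn: "q = wnorm m" "q' = wnorm n" "m \<ge> 1" "n \<ge> 1" by auto
  then have "\<forall>f\<in>HW \<eta>. q f \<le> wnorm (max m n) f \<and> q' f \<le> wnorm (max m n) f"
    by (auto intro!: wnorm_mono)
  moreover have "wnorm (max m n) \<in> wnorms"
    using mn by (auto intro!: exI[of _ "max m n"])
  ultimately show "\<exists>p\<in>wnorms. \<forall>f\<in>HW \<eta>. q f \<le> p f \<and> q' f \<le> p f" ..
qed (auto intro: vector_space_cscale subspace_HW)

sublocale HW: directed_seminorms cscale "HW \<eta> :: ('a::complex_banach \<Rightarrow> complex) set" wnorms
  by (rule directed_seminorms_HW)

section \<open>Completeness of \<open>HW\<close>\<close>

lemma HW_tendsto_pointwise:
  assumes "\<And>m::nat. u m \<in> HW \<eta>" "f \<in> HW \<eta>" "(\<lambda>m. wnorm 1 (u m - f)) \<longlonglongrightarrow> 0"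
  shows "(\<lambda>m. u m x) \<longlonglongrightarrow> f x"
proof -
  have "norm (u m x - f x) \<le> wnorm 1 (u m - f) / weight \<eta> 1 x" for m
    using HW_norm_le[OF HW.diff_mem[OF assms(1,2)], of 1 m x] by simp
  then have "(\<lambda>m. u m x - f x) \<longlonglongrightarrow> 0"
    by (intro Lim_null_comparison[OF _ tendsto_divide_zero[OF assms(3)]] always_eventually allI)
  then show ?thesis
    by (simp add: LIM_zero_iff)
qed

text \<open>Positivity of the first weight gives a pointwise limit. Letting one index of the Cauchy
  condition tend to infinity turns pointwise into weighted uniform convergence, which is locally
  uniform and hence preserves holomorphy.\<close>

lemma HW_complete:
  fixes u :: "nat \<Rightarrow> 'a::complex_banach \<Rightarrow> complex"
  assumes u: "\<And>m. u m \<in> HW \<eta>" and cauchy: "cauchy_for wnorms u"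
  shows "\<exists>f\<in>HW \<eta>. \<forall>n\<ge>1. (\<lambda>m. wnorm n (u m - f)) \<longlonglongrightarrow> 0"
proof -
  have diff: "u m - u n \<in> HW \<eta>" for m n
    using u by (intro HW.diff_mem)
  have cauchy': "\<exists>N. \<forall>m\<ge>N. \<forall>j\<ge>N. wnorm n (u m - u j) < e" if "n \<ge> 1" "e > 0" for n e
    using cauchy that unfolding cauchy_for_def by auto
  have "Cauchy (\<lambda>m. u m x)" for x
  proof (rule metric_CauchyI)
    fix e :: real assume "0 < e"
    then have "0 < e * weight \<eta> 1 x"
      using weight_pos[of 1 x] by simp
    from cauchy'[OF order.refl this]
    obtain N where N: "\<forall>m\<ge>N. \<forall>j\<ge>N. wnorm 1 (u m - u j) < e * weight \<eta> 1 x" ..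
    have "dist (u m x) (u j x) < e" if "m \<ge> N" "j \<ge> N" for m j
    proof -
      have "dist (u m x) (u j x) \<le> wnorm 1 (u m - u j) / weight \<eta> 1 x"
        using HW_norm_le[OF diff, of 1 m j x] by (simp add: dist_norm)
      also have "\<dots> < e"
        using N that weight_pos[of 1 x] by (simp add: pos_divide_less_eq)
      finally show ?thesis .
    qed
    then show "\<exists>N. \<forall>m\<ge>N. \<forall>j\<ge>N. dist (u m x) (u j x) < e" by (intro exI[of _ N]) auto
  qed
  then have "\<exists>l. (\<lambda>m. u m x) \<longlonglongrightarrow> l" for x
    using Cauchy_convergent convergent_def by metis
  then obtain f where f: "(\<lambda>m. u m x) \<longlonglongrightarrow> f x" for x
    by metis
  \<comment> \<open>The index \<open>N\<close> is uniform in \<open>x\<close>, since the Cauchy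
    condition concerns suprema; passing to the limit in \<open>j\<close> weakens the strict
    inequality.\<close>
  have close: "\<exists>N. \<forall>m\<ge>N. \<forall>x. weight \<eta> n x * cmod ((u m - f) x) \<le> e" if n: "n \<ge> 1" and e: "e > 0" for n e
  proof -
    from cauchy'[OF n e] obtain N where N: "\<forall>m\<ge>N. \<forall>j\<ge>N. wnorm n (u m - u j) < e" ..
    have "weight \<eta> n x * cmod ((u m - f) x) \<le> e" if m: "m \<ge> N" for m x
    proof (rule tendsto_upperbound)
      show "(\<lambda>j. weight \<eta> n x * cmod (u m x - u j x)) \<longlonglongrightarrow> weight \<eta> n x * cmod ((u m - f) x)"
        unfolding fun_diff_def by (intro tendsto_intros f)
      have "weight \<eta> n x * cmod (u m x - u j x) \<le> e" if "j \<ge> N" for j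
        using HW_bound[OF diff n, of x m j] N m that by (auto simp: order_less_imp_le intro: order_trans)
      then show "\<forall>\<^sub>F j in sequentially. weight \<eta> n x * cmod (u m x - u j x) \<le> e"
        by (auto intro!: eventually_sequentiallyI[of N])
    qed simp
    then show ?thesis by (intro exI[of _ N]) auto
  qed
  have "holomorphic_fun f"
  proof (rule holomorphic_fun_uniform_limit)
    show "holomorphic_fun (u m)" for m
      using u by (rule HW_holomorphic)
    fix x :: 'a
    \<comment> \<open>A positive lower bound of the first weight on the unit ball around
      \<open>x\<close>, which converts weighted into plain uniform convergence there.\<close>
    let ?w = "\<eta> (norm x + 1)"
    have w: "0 < ?w"
      by (intro pos) simp
    have "uniform_limit (ball x 1) u f sequentially"
    proof (rule uniform_limitI)
      fix e :: real assume e: "0 < e"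
      with w have "0 < ?w * (e / 2)" by simp
      from close[OF order.refl this]
      obtain N where N: "\<forall>m\<ge>N. \<forall>x. weight \<eta> 1 x * cmod ((u m - f) x) \<le> ?w * (e / 2)" ..
      have "dist (u m y) (f y) < e" if "m \<ge> N" "y \<in> ball x 1" for m y
      proof -
        have "norm y \<le> norm x + 1"
          using that norm_triangle_ineq2[of y x] by (simp add: dist_norm norm_minus_commute)
        then have "?w * cmod ((u m - f) y) \<le> weight \<eta> 1 y * cmod ((u m - f) y)"
          by (intro mult_right_mono weight_antimono_norm) auto
        also have "\<dots> \<le> ?w * (e / 2)"
          using N that by auto
        finally have "cmod ((u m - f) y) \<le> e / 2"
          using w by (rule mult_left_le_imp_le)
        then show ?thesis
          using e by (simp add: dist_norm)
      qed
      then show "\<forall>\<^sub>F m in sequentially. \<forall>y\<in>ball x 1. dist (u m y) (f y) < e"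
        by (auto intro!: eventually_sequentiallyI[of N])
    qed
    then show "\<exists>r>0. uniform_limit (ball x r) u f sequentially"
      using zero_less_one by (intro exI[of _ 1] conjI)
  qed
  moreover have "\<exists>B. \<forall>x. weight \<eta> n x * cmod (f x) \<le> B" if n: "n \<ge> 1" for n
  proof -
    from close[OF n zero_less_one]
    obtain N where N: "\<forall>m\<ge>N. \<forall>x. weight \<eta> n x * cmod ((u m - f) x) \<le> 1" ..
    have "weight \<eta> n x * cmod (f x) \<le> wnorm n (u N) + 1" for x
    proof -
      have "cmod (f x) \<le> cmod (u N x) + cmod ((u N - f) x)"
        using norm_triangle_sub[of "f x" "u N x"] by (simp add: norm_minus_commute)
      then have "weight \<eta> n x * cmod (f x)
          \<le> weight \<eta> n x * cmod (u N x) + weight \<eta> n x * cmod ((u N - f) x)"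
        using weight_pos[of n x] unfolding distrib_left[symmetric] by (intro mult_left_mono) auto
      also have "\<dots> \<le> wnorm n (u N) + 1"
        using N by (intro add_mono HW_bound u n) auto
      finally show ?thesis .
    qed
    then show ?thesis by (intro exI[of _ "wnorm n (u N) + 1"]) auto
  qed
  ultimately have fHW: "f \<in> HW \<eta>"
    unfolding HW_iff by auto
  have "(\<lambda>m. wnorm n (u m - f)) \<longlonglongrightarrow> 0" if n: "n \<ge> 1" for n
  proof (rule LIMSEQ_I)
    fix e :: real assume "0 < e"
    from close[OF n half_gt_zero[OF this]]
    obtain N where N: "\<forall>m\<ge>N. \<forall>x. weight \<eta> n x * cmod ((u m - f) x) \<le> e / 2" ..
    have "norm (wnorm n (u m - f) - 0) < e" if "m \<ge> N" for m
    proof -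
      have "wnorm n (u m - f) \<le> e / 2"
        using N that by (intro weighted_norm_le) auto
      then show ?thesis
        using wnorm_nonneg[OF HW.diff_mem[OF u fHW] n, of m] \<open>0 < e\<close> by simp
    qed
    then show "\<exists>N. \<forall>m\<ge>N. norm (wnorm n (u m - f) - 0) < e" by (intro exI[of _ N]) auto
  qed
  with fHW show ?thesis by (intro bexI[of _ f]) auto
qed

lemma frechet_space_HW:
  "frechet_space cscale (HW \<eta> :: ('a::complex_banach \<Rightarrow> complex) set) (HW_topology \<eta>)"
  unfolding frechet_space_def
proof (intro exI conjI)
  \<comment> \<open>The shift by one matches sequences indexed from 0 with weights indexed from
    1.\<close>
  let ?p = "\<lambda>k. wnorm (Suc k) :: ('a \<Rightarrow> complex) \<Rightarrow> real"
  have range: "range ?p = wnorms"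
  proof
    show "wnorms \<subseteq> range ?p"
    proof
      fix q :: "('a \<Rightarrow> complex) \<Rightarrow> real" assume "q \<in> wnorms"
      then obtain n where "q = wnorm n" "n \<ge> 1" by auto
      then have "q = ?p (n - 1)" by simp
      then show "q \<in> range ?p" by (rule range_eqI)
    qed
  qed auto
  show "HW_topology \<eta> = seminorm_topology (HW \<eta>) (range ?p)"
    unfolding HW_topology_def range ..
  show "complete_separating cscale (HW \<eta>) (range ?p)"
    unfolding complete_separating_def range
  proof (intro conjI allI ballI impI)
    show "f = 0" if f: "f \<in> HW \<eta>" "\<forall>q\<in>wnorms. q f = 0" for f :: "'a \<Rightarrow> complex"
    proof
      fix x
      have "wnorm 1 f = 0"
        using f(2) by auto
      then show "f x = 0 x"
        using HW_norm_le[OF f(1), of 1 x] by simp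
    qed
    show "\<exists>f. limitin (seminorm_topology (HW \<eta>) wnorms) u f sequentially"
      if u: "(\<forall>n. u n \<in> HW \<eta>) \<and> cauchy_for wnorms u" for u :: "nat \<Rightarrow> 'a \<Rightarrow> complex"
    proof -
      have uHW: "u m \<in> HW \<eta>" for m
        using u by simp
      from HW_complete[OF uHW u[THEN conjunct2]]
      obtain f where "f \<in> HW \<eta>" "\<forall>n\<ge>1. (\<lambda>m. wnorm n (u m - f)) \<longlonglongrightarrow> 0" ..
      then have "limitin (seminorm_topology (HW \<eta>) wnorms) u f sequentially"
        by (subst HW.limitin_seminorm_topology[OF uHW]) auto
      then show ?thesis by (intro exI[of _ f])
    qed
  qed (auto intro: vector_space_cscale subspace_HW seminorm_on_HW)
qed

section \<open>Cauchy estimates in the weighted norms and the homogeneous subspaces\<close>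

lemma slice_bound:
  assumes f: "f \<in> HW \<eta>" and k: "k \<ge> 1" and c: "cmod c = 2"
  shows "cmod (f (c *\<^sub>C x)) \<le> wnorm (2 * k) f / weight \<eta> k x"
proof -
  have "weight \<eta> (2 * k) (c *\<^sub>C x) = weight \<eta> k x"
    using c by (simp add: weight_def norm_scaleC)
  then show ?thesis
    using HW_norm_le[OF f, of "2 * k" "c *\<^sub>C x"] k by simp
qed

lemma taylor_component_weighted_bound:
  assumes f: "f \<in> HW \<eta>" and k: "k \<ge> 1"
  shows "weight \<eta> k x * cmod (taylor_component n f x) \<le> wnorm (2 * k) f / 2 ^ n"
proof -
  have "cmod ((deriv ^^ n) (\<lambda>c. f (c *\<^sub>C x)) 0) \<le> fact n * (wnorm (2 * k) f / weight \<eta> k x) / 2 ^ n"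
    using f k by (intro Cauchy_estimate_entire slice0_holomorphic HW_holomorphic slice_bound) auto
  then show ?thesis
    using weight_pos[of k x] by (simp add: taylor_component_def norm_divide field_simps)
qed

lemma taylor_remainder_weighted_bound:
  assumes f: "f \<in> HW \<eta>" and k: "k \<ge> 1"
  shows "weight \<eta> k x * cmod (((\<Sum>n<m. taylor_component n f) - f) x) \<le> 2 * wnorm (2 * k) f * (1/2) ^ m"
proof -
  \<comment> \<open>The slice is expanded at \<open>t = 1\<close> with radius 2, the extreme case of
    \<open>cmod t \<le> \<rho> / 2\<close>; this is where the ratio 1/2 comes from.\<close>
  have "cmod (f (1 *\<^sub>C x) - (\<Sum>n<m. (deriv ^^ n) (\<lambda>c. f (c *\<^sub>C x)) 0 / fact n * 1 ^ n))
      \<le> 2 * (wnorm (2 * k) f / weight \<eta> k x) * (cmod 1 / 2) ^ m"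
    using f k by (intro taylor_remainder_bound slice0_holomorphic HW_holomorphic slice_bound) auto
  then have "cmod (((\<Sum>n<m. taylor_component n f) - f) x)
      \<le> 2 * (wnorm (2 * k) f / weight \<eta> k x) * (1 / 2) ^ m"
    by (simp add: sum_fun_apply taylor_component_def norm_minus_commute)
  then show ?thesis
    using weight_pos[of k x] by (simp add: field_simps)
qed

text \<open>A homogeneous member of \<open>HW\<close> is its own \<open>n\<close>-th Taylor
  component, hence a polynomial, and continuity follows from differentiability. From here on
  multilinear forms can be forgotten: only an identity stable under sums and pointwise limits has to
  be checked.\<close>

lemma PW_eq:
  "PW \<eta> n = {f \<in> HW \<eta>. \<forall>c x. f (c *\<^sub>C x) = c ^ n * f x}"
proof (intro equalityI subsetI)
  fix f assume "f \<in> PW \<eta> n"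
  then show "f \<in> {f \<in> HW \<eta>. \<forall>c x. f (c *\<^sub>C x) = c ^ n * f x}"
    by (simp add: PW_def continuous_polynomials_def homogeneous_polynomial_scaleC)
next
  fix f assume f: "f \<in> {f \<in> HW \<eta>. \<forall>c x. f (c *\<^sub>C x) = c ^ n * f x}"
  then have hol: "holomorphic_fun f"
    by (auto intro: HW_holomorphic)
  have "taylor_component n f = f"
    using f by (intro ext taylor_component_id) auto
  then have "homogeneous_polynomial n f"
    using homogeneous_polynomial_taylor_component[OF hol, of n] by simp
  moreover have "continuous_on UNIV f"
    using holomorphic_fun_isCont[OF hol] by (simp add: continuous_at_imp_continuous_on)
  ultimately show "f \<in> PW \<eta> n"
    using f by (simp add: PW_def continuous_polynomials_def)
qed

lemma PW_subset: "PW \<eta> n \<subseteq> HW \<eta>"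
  by (auto simp: PW_def)

lemma taylor_component_PW:
  assumes f: "f \<in> HW \<eta>"
  shows "taylor_component n f \<in> PW \<eta> n"
  unfolding PW_eq
proof (intro CollectI conjI allI)
  show "taylor_component n f \<in> HW \<eta>"
  proof (rule HW_I)
    show "holomorphic_fun (taylor_component n f)"
      using f by (intro holomorphic_fun_taylor_component HW_holomorphic HW_bounded_on_bounded)
  qed (rule taylor_component_weighted_bound[OF f])
  show "taylor_component n f (c *\<^sub>C x) = c ^ n * taylor_component n f x" for c x
    using f by (intro taylor_component_homogeneous HW_holomorphic)
qed

lemma subspace_PW: "module.subspace cscale (PW \<eta> n :: ('a::complex_banach \<Rightarrow> complex) set)"
proof -
  interpret vector_space "cscale :: _ \<Rightarrow> _ \<Rightarrow> 'a \<Rightarrow> complex" by (rule vector_space_cscale)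
  note HW = subspace_HW[where 'a = 'a]
  show ?thesis
    unfolding PW_eq
    using subspace_0[OF HW] subspace_add[OF HW] subspace_scale[OF HW]
    by (intro subspaceI) (auto simp: cscale_def distrib_left)
qed

text \<open>Dilation by \<open>k\<close> turns the \<open>k\<close>-th weight into the first one, as
  \<open>norm (k y) / k = norm y\<close>, while homogeneity contributes \<open>real k ^ n\<close>.
  Dilation is a bijection, so the suprema correspond.\<close>

lemma wnorm_PW:
  fixes f :: "'a::complex_banach \<Rightarrow> complex"
  assumes f: "f \<in> PW \<eta> n" and k: "k \<ge> 1"
  shows "wnorm k f = real k ^ n * wnorm 1 f"
proof (rule antisym)
  have fHW: "f \<in> HW \<eta>" and hom: "\<And>c x. f (c *\<^sub>C x) = c ^ n * f x"
    using f unfolding PW_eq by auto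
  let ?s = "\<lambda>x::'a. complex_of_real (real k) *\<^sub>C x"
  have k0: "real k > 0"
    using k by simp
  have scale: "weight \<eta> k (?s x) * cmod (f (?s x)) = real k ^ n * (weight \<eta> 1 x * cmod (f x))" for x
    using k0 hom[of "complex_of_real (real k)" x]
    by (simp add: weight_def norm_scaleC norm_mult norm_power)
  show "real k ^ n * wnorm 1 f \<le> wnorm k f"
  proof -
    have "wnorm 1 f \<le> wnorm k f / real k ^ n"
    proof (rule weighted_norm_le)
      show "weight \<eta> 1 x * cmod (f x) \<le> wnorm k f / real k ^ n" for x
        using HW_bound[OF fHW k, of "?s x"] k0 unfolding scale by (simp add: field_simps)
    qed
    then show ?thesis
      using k0 by (simp add: field_simps)
  qed
  show "wnorm k f \<le> real k ^ n * wnorm 1 f"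
  proof (rule weighted_norm_le)
    fix x :: 'a
    let ?y = "complex_of_real (inverse (real k)) *\<^sub>C x"
    have "?s ?y = x"
      using k0 by (simp add: scaleC_scaleC flip: of_real_mult)
    then have "weight \<eta> k x * cmod (f x) = real k ^ n * (weight \<eta> 1 ?y * cmod (f ?y))"
      using scale[of ?y] by simp
    also have "\<dots> \<le> real k ^ n * wnorm 1 f"
      by (intro mult_left_mono HW_bound fHW) auto
    finally show "weight \<eta> k x * cmod (f x) \<le> real k ^ n * wnorm 1 f" .
  qed
qed

lemma directed_seminorms_PW:
  "directed_seminorms cscale (PW \<eta> n :: ('a::complex_banach \<Rightarrow> complex) set) {PW_norm \<eta>}"
  unfolding PW_norm_def
  by (rule HW.directed_seminorms_singleton) (auto intro: subspace_PW PW_subset[THEN subsetD])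

text \<open>For fixed \<open>n\<close> each seminorm is a constant multiple of the first. The
  constant \<open>real k ^ n\<close> grows with \<open>n\<close>, so the equivalence is not uniform
  across components; this is what the root condition measures.\<close>

lemma PW_topology:
  "seminorm_topology (PW \<eta> n :: ('a::complex_banach \<Rightarrow> complex) set) {PW_norm \<eta>}
    = subtopology (HW_topology \<eta>) (PW \<eta> n)"
  unfolding PW_norm_def HW_topology_def
proof (rule HW.subtopology_seminorm_topology[OF _ PW_subset subspace_PW])
  show "\<exists>C>0. \<forall>f\<in>PW \<eta> n. p f \<le> C * wnorm 1 f" if p: "p \<in> wnorms"
    for p :: "('a \<Rightarrow> complex) \<Rightarrow> real"
  proof -
    from p obtain k where k: "p = wnorm k" "k \<ge> 1" by auto
    have "p f \<le> real k ^ n * wnorm 1 f" if "f \<in> PW \<eta> n" for f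
      using wnorm_PW[OF that k(2)] k(1) by simp
    with k(2) show ?thesis
      by (intro exI[of _ "real k ^ n"]) auto
  qed
qed auto

text \<open>A sequence that is Cauchy in the first norm is Cauchy in all of them, because
  \<open>wnorm_PW\<close> applies to differences with the same \<open>n\<close>. Its limit in
  \<open>HW\<close> is again homogeneous, since homogeneity is a pointwise identity.\<close>

lemma banach_space_PW:
  "banach_space cscale (PW \<eta> n :: ('a::complex_banach \<Rightarrow> complex) set) (PW_norm \<eta>)"
proof -
  interpret PW: directed_seminorms cscale "PW \<eta> n :: ('a \<Rightarrow> complex) set" "{PW_norm \<eta>}"
    by (rule directed_seminorms_PW)
  show ?thesis
    unfolding banach_space_def complete_separating_def
  proof (intro conjI allI ballI impI)
    show "f = 0" if f: "f \<in> PW \<eta> n" "\<forall>q\<in>{PW_norm \<eta>}. q f = 0" for f :: "'a \<Rightarrow> complex"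
    proof
      fix x
      show "f x = 0 x"
        using HW_norm_le[OF PW_subset[THEN subsetD, OF f(1)], of 1 x] f(2) by (simp add: PW_norm_def)
    qed
    show "\<exists>f. limitin (seminorm_topology (PW \<eta> n) {PW_norm \<eta>}) u f sequentially"
      if PW_cauchy: "(\<forall>n'. u n' \<in> PW \<eta> n) \<and> cauchy_for {PW_norm \<eta>} u" for u :: "nat \<Rightarrow> 'a \<Rightarrow> complex"
    proof -
      have u: "u m \<in> PW \<eta> n" for m
        using PW_cauchy by simp
      have uHW: "u m \<in> HW \<eta>" for m
        using u PW_subset by auto
      have "cauchy_for wnorms u"
        unfolding cauchy_for_def
      proof (intro ballI allI impI)
        fix q :: "('a \<Rightarrow> complex) \<Rightarrow> real" and e :: real
        assume "q \<in> wnorms" and e: "0 < e"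
        then obtain k where k: "q = wnorm k" "k \<ge> 1" by auto
        then have k0: "real k ^ n > 0" by simp
        then have "0 < e / real k ^ n"
          using e by simp
        moreover have "\<forall>e>0. \<exists>N. \<forall>m\<ge>N. \<forall>j\<ge>N. wnorm 1 (u m - u j) < e"
          using PW_cauchy unfolding cauchy_for_def PW_norm_def by simp
        ultimately obtain N where N: "\<forall>m\<ge>N. \<forall>j\<ge>N. wnorm 1 (u m - u j) < e / real k ^ n"
          by metis
        have "q (u m - u j) < e" if "m \<ge> N" "j \<ge> N" for m j
          using N that k0 unfolding k(1) wnorm_PW[OF PW.diff_mem[OF u u] k(2)]
          by (simp add: pos_less_divide_eq mult.commute)
        then show "\<exists>N. \<forall>m\<ge>N. \<forall>j\<ge>N. q (u m - u j) < e" by (intro exI[of _ N]) auto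
      qed
      from HW_complete[OF uHW this]
      obtain f where f: "f \<in> HW \<eta>" "\<forall>n\<ge>1. (\<lambda>m. wnorm n (u m - f)) \<longlonglongrightarrow> 0" ..
      have ptw: "(\<lambda>m. u m x) \<longlonglongrightarrow> f x" for x
        using f by (intro HW_tendsto_pointwise uHW) auto
      have "f (c *\<^sub>C x) = c ^ n * f x" for c x
      proof (rule LIMSEQ_unique[OF ptw])
        show "(\<lambda>m. u m (c *\<^sub>C x)) \<longlonglongrightarrow> c ^ n * f x"
          using tendsto_mult_left[OF ptw[of x], of "c ^ n"] u unfolding PW_eq by simp
      qed
      then have "f \<in> PW \<eta> n"
        using f(1) unfolding PW_eq by simp
      then have "limitin (seminorm_topology (PW \<eta> n) {PW_norm \<eta>}) u f sequentially"
        using f(2)[rule_format, OF order.refl]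
        unfolding PW.limitin_seminorm_topology[OF u] by (simp add: PW_norm_def)
      then show ?thesis by (intro exI[of _ f])
    qed
  qed (auto intro: PW.vector_space PW.subspace PW.seminorm)
qed

section \<open>The decomposition\<close>

lemma sum_PW_HW:
  assumes "\<And>n. y n \<in> PW \<eta> n"
  shows "(\<Sum>n\<in>I. y n) \<in> (HW \<eta> :: ('a::complex_banach \<Rightarrow> complex) set)"
proof -
  interpret vector_space "cscale :: _ \<Rightarrow> _ \<Rightarrow> 'a \<Rightarrow> complex" by (rule vector_space_cscale)
  show ?thesis
    by (rule subspace_sum[OF subspace_HW]) (use assms PW_subset in auto)
qed

lemma limitin_HW_topology:
  assumes "\<And>m::nat. u m \<in> HW \<eta>"
  shows "limitin (HW_topology \<eta>) u f sequentially \<longleftrightarrow>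
    f \<in> HW \<eta> \<and> (\<forall>k\<ge>1. (\<lambda>m. wnorm k (u m - f)) \<longlonglongrightarrow> 0)"
  unfolding HW_topology_def HW.limitin_seminorm_topology[OF assms] by auto

text \<open>For uniqueness, convergence in the first norm implies pointwise convergence; along the
  line through \<open>x\<close> any expansion by homogeneous terms is a power series in
  \<open>c\<close> with coefficients \<open>y n x\<close>, and these are determined by
  \<open>f\<close>.\<close>

lemma expansion_HW:
  assumes f: "f \<in> HW \<eta>"
  shows "expansion (HW_topology \<eta>) (PW \<eta>) f y \<longleftrightarrow> y = (\<lambda>n. taylor_component n f)"
proof
  assume "expansion (HW_topology \<eta>) (PW \<eta>) f y"
  note y = this[unfolded expansion_def, THEN conjunct1, rule_format]
    and limitin = this[unfolded expansion_def, THEN conjunct2]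
  have lim: "(\<lambda>m. wnorm 1 ((\<Sum>n<m. y n) - f)) \<longlonglongrightarrow> 0"
    using limitin unfolding limitin_HW_topology[OF sum_PW_HW[OF y]] by simp
  have "taylor_component n f x = y n x" for n x
  proof (rule taylor_component_eqI[where a = "\<lambda>n. y n x"])
    fix c
    have "(\<lambda>m. (\<Sum>n<m. y n) (c *\<^sub>C x)) \<longlonglongrightarrow> f (c *\<^sub>C x)"
      by (rule HW_tendsto_pointwise[OF sum_PW_HW[OF y] f lim])
    moreover have "y n (c *\<^sub>C x) = y n x * c ^ n" for n
      using y[of n] unfolding PW_eq by (simp add: mult.commute)
    ultimately show "(\<lambda>n. y n x * c ^ n) sums f (c *\<^sub>C x)"
      by (simp add: sums_def sum_fun_apply)
  qed
  then show "y = (\<lambda>n. taylor_component n f)"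
    by (intro ext) simp
next
  let ?y = "\<lambda>n. taylor_component n f"
  assume y: "y = ?y"
  have conv: "(\<lambda>m. wnorm k ((\<Sum>n<m. ?y n) - f)) \<longlonglongrightarrow> 0" if k: "k \<ge> 1" for k
  proof (rule tendsto_sandwich[OF _ _ tendsto_const])
    show "(\<lambda>m. 2 * wnorm (2 * k) f * (1/2) ^ m) \<longlonglongrightarrow> 0"
      by (intro tendsto_mult_right_zero LIMSEQ_power_zero) simp
    show "\<forall>\<^sub>F m in sequentially. wnorm k ((\<Sum>n<m. ?y n) - f) \<le> 2 * wnorm (2 * k) f * (1/2) ^ m"
      by (intro always_eventually allI weighted_norm_le taylor_remainder_weighted_bound f k)
    show "\<forall>\<^sub>F m in sequentially. 0 \<le> wnorm k ((\<Sum>n<m. ?y n) - f)"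
      by (intro always_eventually allI wnorm_nonneg HW.diff_mem sum_PW_HW taylor_component_PW f k)
  qed
  show "expansion (HW_topology \<eta>) (PW \<eta>) f y"
    unfolding expansion_def y limitin_HW_topology[OF sum_PW_HW[OF taylor_component_PW[OF f]]]
    by (intro conjI allI impI taylor_component_PW f conv)
qed

lemma schauder_projection_HW:
  assumes "f \<in> HW \<eta>"
  shows "schauder_projection (HW_topology \<eta>) (PW \<eta>) m f = (\<Sum>n\<le>m. taylor_component n f)"
  unfolding schauder_projection_def expansion_HW[OF assms] by simp

lemma continuous_schauder_projection_HW:
  "continuous_map (HW_topology \<eta>) (HW_topology \<eta>)
    (schauder_projection (HW_topology \<eta>) (PW \<eta>) m :: ('a::complex_banach \<Rightarrow> complex) \<Rightarrow> _)"
proof -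
  let ?S = "schauder_projection (HW_topology \<eta>) (PW \<eta>) m :: ('a \<Rightarrow> complex) \<Rightarrow> _"
  have "continuous_map (seminorm_topology (HW \<eta>) wnorms) (seminorm_topology (HW \<eta>) wnorms) ?S"
  proof (rule HW.continuous_map_seminorm_topology)
    show "?S f \<in> HW \<eta>" if "f \<in> HW \<eta>" for f
      unfolding schauder_projection_HW[OF that] using that by (intro sum_PW_HW taylor_component_PW)
    show "?S (f - g) = ?S f - ?S g" if f: "f \<in> HW \<eta>" and g: "g \<in> HW \<eta>" for f g
      unfolding schauder_projection_HW[OF f] schauder_projection_HW[OF g]
        schauder_projection_HW[OF HW.diff_mem[OF f g]]
      using f[THEN HW_holomorphic] g[THEN HW_holomorphic]
      by (simp add: fun_eq_iff sum_fun_apply taylor_component_diff sum_subtractf)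
    show "\<exists>p\<in>wnorms. \<exists>C>0. \<forall>f\<in>HW \<eta>. q (?S f) \<le> C * p f" if q: "q \<in> wnorms" for q
    proof -
      from q obtain k where k: "q = wnorm k" "k \<ge> 1" by auto
      \<comment> \<open>There are \<open>Suc m\<close> components, and each gain
        \<open>1 / 2 ^ n\<close> is estimated by 1; a constant depending on \<open>m\<close> is
        harmless because \<open>m\<close> is fixed.\<close>
      have "q (?S f) \<le> real (Suc m) * wnorm (2 * k) f" if f: "f \<in> HW \<eta>" for f
        unfolding k(1) schauder_projection_HW[OF f]
      proof (rule weighted_norm_le)
        fix x
        have "weight \<eta> k x * cmod ((\<Sum>n\<le>m. taylor_component n f) x)
            \<le> weight \<eta> k x * (\<Sum>n\<le>m. cmod (taylor_component n f x))"
          unfolding sum_fun_apply using weight_pos[of k x] by (intro mult_left_mono norm_sum) auto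
        also have "\<dots> = (\<Sum>n\<le>m. weight \<eta> k x * cmod (taylor_component n f x))"
          by (rule sum_distrib_left)
        also have "\<dots> \<le> (\<Sum>n\<le>m. wnorm (2 * k) f)"
        proof (rule sum_mono)
          fix n
          have "wnorm (2 * k) f / 2 ^ n \<le> wnorm (2 * k) f / 1"
            using wnorm_nonneg[OF f, of "2 * k"] k(2) by (intro divide_left_mono) auto
          with taylor_component_weighted_bound[OF f k(2), of x n]
          show "weight \<eta> k x * cmod (taylor_component n f x) \<le> wnorm (2 * k) f" by simp
        qed
        finally show "weight \<eta> k x * cmod ((\<Sum>n\<le>m. taylor_component n f) x) \<le> real (Suc m) * wnorm (2 * k) f"
          by simp
      qed
      then show ?thesis
        using k(2) by (intro bexI[of _ "wnorm (2 * k)"] exI[of _ "real (Suc m)"] conjI ballI)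
          (auto intro!: exI[of _ "2 * k"])
    qed
  qed
  then show ?thesis
    unfolding HW_topology_def .
qed

lemma schauder_decomposition_HW:
  "schauder_decomposition cscale (HW \<eta> :: ('a::complex_banach \<Rightarrow> complex) set) (HW_topology \<eta>) (PW \<eta>)"
  unfolding schauder_decomposition_def
  using frechet_space_HW subspace_PW PW_subset continuous_schauder_projection_HW
  by (auto simp: expansion_HW)

text \<open>The terms of a convergent series tend to 0 in every seminorm. For index \<open>k\<close>
  this gives \<open>real k ^ n * wnorm 1 (y n) < 1\<close> eventually, so the roots are eventually
  at most \<open>1 / k\<close>, for every \<open>k\<close>.\<close>

lemma root_limsup_of_limitin:
  fixes y :: "nat \<Rightarrow> 'a::complex_banach \<Rightarrow> complex"
  assumes y: "\<And>n. y n \<in> PW \<eta> n"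
    and lim: "limitin (HW_topology \<eta>) (\<lambda>m. \<Sum>n<m. y n) f sequentially"
  shows "limsup (\<lambda>n. ereal (root n (wnorm 1 (y n)))) \<le> 0"
proof -
  let ?S = "\<lambda>m. \<Sum>n<m. y n"
  have S: "?S m \<in> HW \<eta>" for m
    using y by (rule sum_PW_HW)
  have f: "f \<in> HW \<eta>" and conv: "\<And>k. k \<ge> 1 \<Longrightarrow> (\<lambda>m. wnorm k (?S m - f)) \<longlonglongrightarrow> 0"
    using lim limitin_HW_topology[OF S] by auto
  have bound: "limsup (\<lambda>n. ereal (root n (wnorm 1 (y n)))) \<le> ereal (inverse (real (Suc j)))" for j
  proof (rule Limsup_bounded)
    let ?k = "Suc j"
    have "(\<lambda>m. wnorm ?k (?S (Suc m) - f) + wnorm ?k (?S m - f)) \<longlonglongrightarrow> 0 + 0"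
      by (intro tendsto_add LIMSEQ_Suc[OF conv] conv) simp_all
    then have "\<forall>\<^sub>F n in sequentially. wnorm ?k (?S (Suc n) - f) + wnorm ?k (?S n - f) < 1"
      by (rule order_tendstoD(2)) simp
    then show "\<forall>\<^sub>F n in sequentially. ereal (root n (wnorm 1 (y n))) \<le> ereal (inverse (real ?k))"
      \<comment> \<open>Discards \<open>n = 0\<close>, where \<open>root 0\<close> is constantly 0
        and does not invert the power.\<close>
      using eventually_gt_at_top[of 0]
    proof eventually_elim
      case (elim n)
      have "wnorm ?k (?S (Suc n) - ?S n) \<le> wnorm ?k (?S (Suc n) - f) + wnorm ?k (f - ?S n)"
        by (intro HW.seminorm_diff_triangle S f CollectI exI[of _ ?k]) simp
      also have "?S (Suc n) - ?S n = y n" by simp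
      also have "wnorm ?k (f - ?S n) = wnorm ?k (?S n - f)"
        by (rule weighted_norm_minus_commute)
      also note elim(1)
      finally have "real ?k ^ n * wnorm 1 (y n) < 1"
        using wnorm_PW[OF y, of ?k n] by simp
      then have "wnorm 1 (y n) \<le> inverse (real ?k) ^ n"
        by (simp add: field_simps del: of_nat_Suc)
      then have "root n (wnorm 1 (y n)) \<le> root n (inverse (real ?k) ^ n)"
        using elim(2) by simp
      also have "\<dots> = inverse (real ?k)"
        using elim(2) by (intro real_root_power_cancel) auto
      finally show ?case by simp
    qed
  qed
  have "(\<lambda>j. ereal (inverse (real (Suc j)))) \<longlonglongrightarrow> ereal 0"
    using LIMSEQ_inverse_real_of_nat by simp
  from tendsto_lowerbound[OF this always_eventually] bound show ?thesis
    by (simp add: zero_ereal_def)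
qed

text \<open>Roots eventually below \<open>1 / (2 * k)\<close> compensate the factor
  \<open>real k ^ n\<close> and leave \<open>(1/2) ^ n\<close>, so the series converges absolutely
  in every seminorm; completeness of \<open>HW\<close> does the rest.\<close>

lemma limitin_of_root_limsup:
  fixes y :: "nat \<Rightarrow> 'a::complex_banach \<Rightarrow> complex"
  assumes y: "\<And>n. y n \<in> PW \<eta> n"
    and limsup: "limsup (\<lambda>n. ereal (root n (wnorm 1 (y n)))) \<le> 0"
  shows "\<exists>f. limitin (HW_topology \<eta>) (\<lambda>m. \<Sum>n<m. y n) f sequentially"
proof -
  let ?S = "\<lambda>m. \<Sum>n<m. y n"
  have yHW: "y n \<in> HW \<eta>" for n
    using y PW_subset by auto
  have S: "?S m \<in> HW \<eta>" for m
    using y by (rule sum_PW_HW)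
  have summable: "summable (\<lambda>n. wnorm k (y n))" if k: "k \<ge> 1" for k
  proof (rule summable_comparison_test_ev)
    have half: "real k * inverse (2 * real k) = 1/2"
      using k by (simp add: field_simps)
    have "limsup (\<lambda>n. ereal (root n (wnorm 1 (y n)))) < ereal (inverse (2 * real k))"
      using limsup by (rule le_less_trans) (use k in simp)
    then have "\<forall>\<^sub>F n in sequentially. ereal (root n (wnorm 1 (y n))) < ereal (inverse (2 * real k))"
      by (rule Limsup_lessD)
    then show "\<forall>\<^sub>F n in sequentially. norm (wnorm k (y n)) \<le> (1/2) ^ n"
      using eventually_gt_at_top[of 0]
    proof eventually_elim
      case (elim n)
      have nonneg: "0 \<le> wnorm 1 (y n)"
        using yHW by (rule wnorm_nonneg) simp
      have "wnorm 1 (y n) = root n (wnorm 1 (y n)) ^ n"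
        using elim(2) nonneg by simp
      also have "\<dots> \<le> inverse (2 * real k) ^ n"
        using elim nonneg by (intro power_mono) auto
      finally have "real k ^ n * wnorm 1 (y n) \<le> real k ^ n * inverse (2 * real k) ^ n"
        by (intro mult_left_mono) auto
      also have "\<dots> = (1/2) ^ n"
        by (simp only: power_mult_distrib[symmetric] half)
      finally show ?case
        using wnorm_PW[OF y k, of n] nonneg by simp
    qed
  qed (simp add: summable_geometric)
  \<comment> \<open>Differences of partial sums are dominated by those of a convergent real series,
    from which the Cauchy property is transferred.\<close>
  have S_diff: "wnorm k (?S b - ?S a) \<le> (\<Sum>n<b. wnorm k (y n)) - (\<Sum>n<a. wnorm k (y n))"
    if "k \<ge> 1" "a \<le> b" for k a b
  proof (rule weighted_norm_le)
    fix x
    have "weight \<eta> k x * cmod ((?S b - ?S a) x) = weight \<eta> k x * cmod (\<Sum>n=a..<b. y n x)"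
      using sum_diff_nat_ivl[of 0 a b "\<lambda>n. y n x"] \<open>a \<le> b\<close> by (simp add: sum_fun_apply lessThan_atLeast0)
    also have "\<dots> \<le> weight \<eta> k x * (\<Sum>n=a..<b. cmod (y n x))"
      using weight_pos[of k x] by (intro mult_left_mono norm_sum) auto
    also have "\<dots> = (\<Sum>n=a..<b. weight \<eta> k x * cmod (y n x))"
      by (rule sum_distrib_left)
    also have "\<dots> \<le> (\<Sum>n=a..<b. wnorm k (y n))"
      using that by (intro sum_mono HW_bound yHW)
    also have "\<dots> = (\<Sum>n<b. wnorm k (y n)) - (\<Sum>n<a. wnorm k (y n))"
      using sum_diff_nat_ivl[of 0 a b "\<lambda>n. wnorm k (y n)"] \<open>a \<le> b\<close> by (simp add: lessThan_atLeast0)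
    finally show "weight \<eta> k x * cmod ((?S b - ?S a) x)
        \<le> (\<Sum>n<b. wnorm k (y n)) - (\<Sum>n<a. wnorm k (y n))" .
  qed
  have "cauchy_for wnorms ?S"
    unfolding cauchy_for_def
  proof (intro ballI allI impI)
    fix q :: "('a \<Rightarrow> complex) \<Rightarrow> real" and e :: real
    assume "q \<in> wnorms" and e: "0 < e"
    then obtain k where k: "q = wnorm k" "k \<ge> 1" by auto
    let ?R = "\<lambda>m. \<Sum>n<m. wnorm k (y n)"
    have "Cauchy ?R"
      using summable[OF k(2)] by (intro convergent_Cauchy) (simp add: summable_iff_convergent)
    then obtain N where N: "\<forall>m\<ge>N. \<forall>n\<ge>N. dist (?R m) (?R n) < e"
      using e metric_CauchyD by blast
    have "q (?S m - ?S n) < e" if "m \<ge> N" "n \<ge> N" for m n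
    proof -
      have R: "dist (?R m) (?R n) < e"
        using N that by auto
      show ?thesis
      proof (cases "n \<le> m")
        case True
        then show ?thesis
          using S_diff[OF k(2) True] R unfolding k(1) dist_real_def by linarith
      next
        case False
        then show ?thesis
          using S_diff[OF k(2), of m n] R
          unfolding k(1) dist_real_def weighted_norm_minus_commute[of _ "?S m"] by linarith
      qed
    qed
    then show "\<exists>N. \<forall>m\<ge>N. \<forall>n\<ge>N. q (?S m - ?S n) < e" by (intro exI[of _ N]) auto
  qed
  from HW_complete[OF S this]
  obtain f where "f \<in> HW \<eta>" "\<forall>n\<ge>1. (\<lambda>m. wnorm n (?S m - f)) \<longlonglongrightarrow> 0" ..
  then have "limitin (HW_topology \<eta>) ?S f sequentially"
    by (simp add: limitin_HW_topology[OF S])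
  then show ?thesis by (intro exI[of _ f])
qed

end

theorem proposition2p3:
  fixes \<eta> :: "real \<Rightarrow> real"
  assumes "\<And>t. 0 \<le> t \<Longrightarrow> 0 < \<eta> t"
    and "antimono_on {0..} \<eta>"
    and "continuous_on {0..} \<eta>"
    and "\<And>k :: nat. ((\<lambda>t. t ^ k * \<eta> t) \<longlongrightarrow> 0) at_top"
  shows "R_schauder_decomposition cscale
    (HW \<eta> :: ('a::complex_banach \<Rightarrow> complex) set) (HW_topology \<eta>) (PW \<eta>) (\<lambda>n. PW_norm \<eta>) \<infinity>"
proof -
  interpret decreasing_weight \<eta>
    using assms(1,2) by unfold_locales (auto simp: monotone_on_def)
  have "(\<exists>f. limitin (HW_topology \<eta>) (\<lambda>m. \<Sum>n<m. y n) f sequentially) \<longleftrightarrow>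
      limsup (\<lambda>n. ereal (root n (PW_norm \<eta> (y n)))) \<le> 1 / \<infinity>"
    if "\<forall>n. y n \<in> PW \<eta> n" for y :: "nat \<Rightarrow> 'a \<Rightarrow> complex"
    using that root_limsup_of_limitin[of y] limitin_of_root_limsup[of y]
    by (auto simp: PW_norm_def)
  then show ?thesis
    unfolding R_schauder_decomposition_def
    using schauder_decomposition_HW banach_space_PW PW_topology by auto
qed

end
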